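(* For each $n\geq 1$ and each nonnegative integer $k$, $$\dim\mathcal{P}_{2k}(\mathbb{R}^n)=\sum_{i=0}^{k}\dim\mathcal{H}_{2i}(\mathbb{R}^n).$$
   Context: $\Delta$ is the Euclidean Laplacian on $\mathbb{R}^n$ and $B_R(p)$ is the Euclidean ball of radius $R$ about $p$. For $d\ge 0$, $\mathcal{H}_d(\mathbb{R}^n)$ is the real vector space of harmonic functions $u:\mathbb{R}^n\to\mathbb{R}$ such that for some $p\in \mathbb{R}^n$ and a constant $C_u$ depending on $u$, $\sup_{B_R(p)}|u|\leq C_u(1+R)^d$ for all $R>0$. For $d\ge 0$, $\mathcal{P}_d(\mathbb{R}^n)$ is the real vector space of smooth ancient solutions $u:\mathbb{R}^n\times(-\infty,0]\to\mathbb{R}$ of the heat equation $\partial_t u=\Delta u$ such that for some $p\in \mathbb{R}^n$ and a constant $C_u$ depending on $u$, $\sup_{B_R(p)\times[-R^2,0]}|u|\leq C_u(1+R)^d$ for all $R>0$. *)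

theory Defs
  imports
    "HOL-Analysis.Analysis"
    "HOL-Library.Function_Algebras"
    "HOL-Library.Extended_Nat"
begin

global_interpretation real_fun: vector_space "\<lambda>(c::real) (f::'a \<Rightarrow> real). (\<lambda>x. c * f x)"
  by unfold_locales (simp_all add: fun_eq_iff algebra_simps)

text \<open>
  The library's \<^term>\<open>real_fun.dim\<close> is a natural number and takes the value 0 on
  infinite-dimensional spaces, so the dimension is taken in \<^typ>\<open>enat\<close> here.
\<close>

definition fun_dim :: "('a \<Rightarrow> real) set \<Rightarrow> enat" where
  "fun_dim V =
    (if \<exists>B. finite B \<and> V \<subseteq> real_fun.span B then enat (real_fun.dim V) else \<infinity>)"

text \<open>
  Derivatives are taken within \<open>S\<close>, i.e. one-sided at boundary points. They are unique when
  \<open>S\<close> is convex with nonempty interior, which covers the two uses below: the whole space and the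
  closed half space \<^term>\<open>UNIV \<times> {..0}\<close>.
\<close>

fun Ck_on :: "nat \<Rightarrow> 'a::euclidean_space set \<Rightarrow> ('a \<Rightarrow> real) \<Rightarrow> bool" where
  "Ck_on 0 S f \<longleftrightarrow> continuous_on S f"
| "Ck_on (Suc k) S f \<longleftrightarrow>
    (\<exists>f'. (\<forall>x\<in>S. (f has_derivative f' x) (at x within S)) \<and> (\<forall>v. Ck_on k S (\<lambda>x. f' x v)))"

definition smooth_on :: "'a::euclidean_space set \<Rightarrow> ('a \<Rightarrow> real) \<Rightarrow> bool" where
  "smooth_on S f \<longleftrightarrow> (\<forall>k. Ck_on k S f)"

definition laplacian :: "(real^'n \<Rightarrow> real) \<Rightarrow> real^'n \<Rightarrow> real" where
  "laplacian f x = (\<Sum>i\<in>UNIV. (deriv ^^ 2) (\<lambda>s. f (x + s *\<^sub>R axis i 1)) 0)"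

definition harmonic :: "(real^'n \<Rightarrow> real) \<Rightarrow> bool" where
  "harmonic u \<longleftrightarrow> Ck_on 2 UNIV u \<and> (\<forall>x. laplacian u x = 0)"

definition harmonic_growth :: "real \<Rightarrow> (real^'n \<Rightarrow> real) set" where
  "harmonic_growth d =
    {u. harmonic u \<and>
        (\<exists>p C. \<forall>R>0. \<forall>x\<in>ball p R. \<bar>u x\<bar> \<le> C * (1 + R) powr d)}"

text \<open>
  A function on \<open>\<real>\<^sup>n \<times> (-\<infinity>, 0]\<close> is represented by its extension by zero to positive times, so
  that equality of functions on the domain is equality in HOL and the linear structure is the
  pointwise one.
\<close>

definition ancient_solution :: "((real^'n) \<times> real \<Rightarrow> real) \<Rightarrow> bool" where
  "ancient_solution u \<longleftrightarrow>
    smooth_on (UNIV \<times> {..0}) u \<and>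
    (\<forall>x. \<forall>t\<le>0. ((\<lambda>s. u (x, s)) has_real_derivative laplacian (\<lambda>y. u (y, t)) x)
                  (at t within {..0})) \<and>
    (\<forall>x. \<forall>t>0. u (x, t) = 0)"

definition ancient_growth :: "real \<Rightarrow> ((real^'n) \<times> real \<Rightarrow> real) set" where
  "ancient_growth d =
    {u. ancient_solution u \<and>
        (\<exists>p C. \<forall>R>0. \<forall>x\<in>ball p R. \<forall>t\<in>{-(R\<^sup>2)..0}. \<bar>u (x, t)\<bar> \<le> C * (1 + R) powr d)}"

end

theory Submission
  imports Defs
begin

text \<open>
  Write \<open>polys m\<close> for the space of polynomials on \<open>\<real>\<^sup>n\<close> of degree at most \<open>m\<close>. The two sides of the theorem
  are both equal to the dimension of \<open>polys (2 * k)\<close>.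

  For the left-hand side, an ancient solution is determined by its values at time zero, which form a
  polynomial of degree at most \<open>2 * k\<close>; conversely every such polynomial \<open>p\<close> is attained, by the finite sum
  of the terms \<open>t\<^sup>j / j!\<close> times the \<open>j\<close>-th iterated Laplacian of \<open>p\<close> (\<open>heat_extension_image\<close>). For the
  right-hand side, the harmonic functions of growth order \<open>m\<close> are the harmonic elements of \<open>polys m\<close>
  (\<open>harmonic_growth_eq_polys\<close>), and the Laplacian maps \<open>polys (m + 2)\<close> onto \<open>polys m\<close>
  (\<open>laplacian_onto_polys\<close>), so that \<open>dim (polys (m + 2)) - dim (polys m)\<close> is the dimension of the harmonic
  functions of order \<open>m + 2\<close>. Summing over even orders up to \<open>2 * k\<close> telescopes, starting from \<open>polys 0\<close>,
  whose elements are all harmonic.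

  The analytic core is a Liouville theorem, obtained without a mean value formula or derivative estimates.
  Comparing a solution with its reflection in a hyperplane on a parabolic cube of size \<open>R\<close>, by the maximum
  principle and an explicit quadratic barrier, bounds the central difference \<open>u (x + h e, t) - u (x - h e, t)\<close>
  along a coordinate axis by a constant times \<open>h / R\<close> times the maximum of \<open>\<bar>u\<bar>\<close> on the cube
  (\<open>reflection_estimate\<close>). So central differences of a solution of growth order \<open>m + 1\<close> are solutions of
  growth order \<open>m\<close>, and those of a bounded solution vanish. Induction on the order shows that the time slices
  of a solution are polynomials (\<open>caloric_slice_in_polys\<close>), and that a solution with zero values at time zero
  is zero (\<open>caloric_unique\<close>). Differences rather than derivatives are used because they preserve the weak
  class \<open>caloric\<close> in which the induction runs; derivatives enter only once, as limits of difference quotients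
  in a finite-dimensional space of polynomials (\<open>polys_of_central_differences\<close>).
\<close>

section \<open>Dimensions of spaces of real functions\<close>

lemma fun_dim_span_finite:
  assumes "finite B" "V \<subseteq> real_fun.span B"
  shows "fun_dim V = enat (real_fun.dim V)"
  using assms by (auto simp: fun_dim_def)

text \<open>
  The Laplacian is linear on smooth functions only, so additivity and homogeneity are assumed on
  \<open>V\<close> alone. The proof passes to the linear map \<open>M\<close> that agrees with \<open>L\<close> on a basis of \<open>V\<close>
  extending a basis of the kernel.
\<close>

lemma fun_dim_rank_nullity:
  fixes L :: "('a \<Rightarrow> real) \<Rightarrow> ('b \<Rightarrow> real)"
  assumes V: "real_fun.subspace V" and fin: "finite S" "V \<subseteq> real_fun.span S"
    and add: "\<And>f g. f \<in> V \<Longrightarrow> g \<in> V \<Longrightarrow> L (f + g) = L f + L g"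
    and scale: "\<And>c f. f \<in> V \<Longrightarrow> L (\<lambda>x. c * f x) = (\<lambda>x. c * L f x)"
  shows "fun_dim V = fun_dim {f \<in> V. L f = 0} + fun_dim (L ` V)"
proof -
  interpret P: vector_space_pair "\<lambda>(c::real) (f::'a \<Rightarrow> real). (\<lambda>x. c * f x)"
    "\<lambda>(c::real) (f::'b \<Rightarrow> real). (\<lambda>x. c * f x)" ..
  let ?K = "{f \<in> V. L f = 0}"
  obtain A where A: "A \<subseteq> ?K" "real_fun.independent A" "?K \<subseteq> real_fun.span A"
    by (rule real_fun.basis_exists[of ?K]) auto
  obtain B where B: "A \<subseteq> B" "B \<subseteq> V" "real_fun.independent B" "V \<subseteq> real_fun.span B"
    by (rule real_fun.maximal_independent_subset_extend[of A V]) (use A in auto)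
  have spanB: "real_fun.span B = V"
    using B V by (simp add: real_fun.span_minimal subset_antisym)
  have finB: "finite B"
    using real_fun.independent_span_bound[OF fin(1) B(3)] B(2) fin(2) by auto
  define C where "C = B - A"
  define M where "M = P.construct B L"
  have M: "Vector_Spaces.linear (\<lambda>(c::real) (f::'a \<Rightarrow> real). (\<lambda>x. c * f x))
      (\<lambda>(c::real) (f::'b \<Rightarrow> real). (\<lambda>x. c * f x)) M"
    unfolding M_def by (rule P.linear_construct[OF B(3)])
  then interpret M: Vector_Spaces.linear "\<lambda>(c::real) (f::'a \<Rightarrow> real). (\<lambda>x. c * f x)"
    "\<lambda>(c::real) (f::'b \<Rightarrow> real). (\<lambda>x. c * f x)" M .
  have MB: "M b = L b" if "b \<in> B" for b
    unfolding M_def using P.construct_basis[OF B(3) that] .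
  have "0 \<in> V" using V by (rule real_fun.subspace_0)
  have L0: "L 0 = 0" using scale[OF \<open>0 \<in> V\<close>, of 0] by (simp add: zero_fun_def)
  have MV: "M f = L f" if "f \<in> V" for f
  proof -
    have "f \<in> real_fun.span B" using that B(4) by auto
    then have "f \<in> V \<and> M f = L f"
    proof (induction rule: real_fun.span_induct_alt)
      case base
      then show ?case by (metis \<open>0 \<in> V\<close> L0 M.zero)
    next
      case (step c x y)
      then have x: "x \<in> V" using B(2) by auto
      have cx: "(\<lambda>z. c * x z) \<in> V"
        by (rule real_fun.subspace_scale[OF V x])
      have "M ((\<lambda>z. c * x z) + y) = L ((\<lambda>z. c * x z) + y)"
        using add[OF cx] scale[OF x] step MB[of x] by (simp add: M.add M.scale)
      moreover have "(\<lambda>z. c * x z) + y \<in> V"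
        by (rule real_fun.subspace_add[OF V cx]) (use step in blast)
      ultimately show ?case by blast
    qed
    then show ?thesis by simp
  qed
  have "real_fun.span A \<inter> real_fun.span C \<subseteq> {0}"
  proof
    fix x assume x: "x \<in> real_fun.span A \<inter> real_fun.span C"
    have r: "real_fun.representation B x = real_fun.representation A x"
      "real_fun.representation B x = real_fun.representation C x"
      by (rule real_fun.representation_extend; use x B in \<open>auto simp: C_def\<close>)+
    have "real_fun.representation B x b = 0" for b
      using r real_fun.representation_ne_zero[of A x b] real_fun.representation_ne_zero[of C x b]
      by (auto simp: C_def)
    moreover have "x \<in> real_fun.span B" using x B real_fun.span_mono by blast
    ultimately show "x \<in> {0}"
      using real_fun.sum_nonzero_representation_eq[OF B(3), of x] by simp
  qed
  have CV: "real_fun.span C \<subseteq> V"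
    using spanB real_fun.span_mono[of C B] by (auto simp: C_def)
  have inj: "inj_on M (real_fun.span C)"
  proof (subst M.inj_on_iff_eq_0)
    show "real_fun.subspace (real_fun.span C)" by simp
    show "\<forall>x\<in>real_fun.span C. M x = 0 \<longrightarrow> x = 0"
    proof (intro ballI impI)
      fix x assume x: "x \<in> real_fun.span C" "M x = 0"
      then have "x \<in> V" using CV by blast
      then have "x \<in> real_fun.span A" using x(2) MV A(3) by auto
      then show "x = 0" using x(1) \<open>real_fun.span A \<inter> real_fun.span C \<subseteq> {0}\<close> by blast
    qed
  qed
  have indC: "real_fun.independent C"
    unfolding C_def by (rule real_fun.independent_mono[OF B(3)]) blast
  have ind: "real_fun.independent (M ` C)"
    by (rule M.independent_injective_image[OF indC inj])
  have "M ` V \<subseteq> real_fun.span (M ` C)"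
  proof -
    have "M ` B \<subseteq> insert 0 (M ` C)"
      using A(1) B(2) MV by (auto simp: C_def)
    then have "real_fun.span (M ` B) \<subseteq> real_fun.span (M ` C)"
      using real_fun.span_mono[of "M ` B" "insert 0 (M ` C)"] by simp
    then show ?thesis using spanB M.span_image[of B] by simp
  qed
  then have LV: "L ` V \<subseteq> real_fun.span (M ` C)" using MV by (auto simp: image_subset_iff)
  have MC: "M ` C \<subseteq> L ` V" using B(2) MB by (auto simp: C_def)
  have "real_fun.dim V = card B"
    using real_fun.dim_unique[OF B(2,4,3)] by simp
  moreover have "real_fun.dim ?K = card A"
    using real_fun.dim_unique[OF A(1,3,2)] by simp
  moreover have "real_fun.dim (L ` V) = card C"
  proof -
    have "inj_on M C" using inj real_fun.span_superset inj_on_subset by blast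
    then have "card (M ` C) = card C" by (rule card_image)
    then show ?thesis using real_fun.dim_unique[OF MC LV ind] by simp
  qed
  moreover have "card B = card A + card C"
    using finB B(1) card_mono[of B A] by (simp add: C_def card_Diff_subset finite_subset)
  moreover have "finite (M ` C)" using finB by (simp add: C_def)
  moreover have "?K \<subseteq> real_fun.span S" using fin by auto
  ultimately show ?thesis
    using fun_dim_span_finite[OF fin] fun_dim_span_finite[OF fin(1), of ?K] 
      fun_dim_span_finite[OF _ LV] by simp
qed

lemma fun_dim_image_inj:
  fixes L :: "('a \<Rightarrow> real) \<Rightarrow> ('b \<Rightarrow> real)"
  assumes V: "real_fun.subspace V" and fin: "finite S" "V \<subseteq> real_fun.span S"
    and add: "\<And>f g. f \<in> V \<Longrightarrow> g \<in> V \<Longrightarrow> L (f + g) = L f + L g"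
    and scale: "\<And>c f. f \<in> V \<Longrightarrow> L (\<lambda>x. c * f x) = (\<lambda>x. c * L f x)"
    and ker: "\<And>f. f \<in> V \<Longrightarrow> L f = 0 \<Longrightarrow> f = 0"
  shows "fun_dim (L ` V) = fun_dim V"
proof -
  have "{f \<in> V. L f = 0} \<subseteq> real_fun.span {}" using ker by auto
  then have "fun_dim {f \<in> V. L f = 0} = enat (real_fun.dim {f \<in> V. L f = 0})"
    "real_fun.dim {f \<in> V. L f = 0} \<le> card ({} :: ('a \<Rightarrow> real) set)"
    using fun_dim_span_finite[of "{}"] real_fun.dim_le_card[of _ "{}"] by auto
  then have "fun_dim {f \<in> V. L f = 0} = 0" by (simp add: zero_enat_def)
  moreover have "fun_dim V = fun_dim {f \<in> V. L f = 0} + fun_dim (L ` V)"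
    by (rule fun_dim_rank_nullity[OF V fin]) (fact add scale)+
  ultimately show ?thesis by simp
qed


text \<open>
  A finite-dimensional space of functions is closed under pointwise limits. By induction on the
  spanning set: if the coefficients \<open>c k\<close> of the new generator \<open>b\<close> have a bounded subsequence, they
  can be made convergent and their contribution subtracted; otherwise \<open>\<bar>c k\<bar> \<rightarrow> \<infinity>\<close>, and dividing by
  \<open>c k\<close> exhibits \<open>b\<close> as a limit of elements of the smaller span.
\<close>

lemma span_closed_pointwise:
  fixes f :: "nat \<Rightarrow> 'a \<Rightarrow> real"
  assumes "finite B" "\<And>k. f k \<in> real_fun.span B" "\<And>x. (\<lambda>k. f k x) \<longlonglongrightarrow> g x"
  shows "g \<in> real_fun.span B"
  using assms
proof (induction B arbitrary: f g rule: finite_induct)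
  case empty
  then have "f k x = 0" for k x by (simp add: zero_fun_def)
  with empty have "g x = 0" for x by (simp add: LIMSEQ_const_iff)
  then have "g = 0" by (simp add: fun_eq_iff)
  then show ?case by (metis real_fun.span_zero)
next
  case (insert b B)
  from insert.prems(1) have "\<forall>k. \<exists>c. f k - (\<lambda>x. c * b x) \<in> real_fun.span B"
    unfolding real_fun.span_insert by blast
  from choice[OF this] obtain c where c: "\<And>k. f k - (\<lambda>x. c k * b x) \<in> real_fun.span B"
    by blast
  show ?case
  proof (cases "filterlim c at_infinity sequentially")
    case True
    have "(\<lambda>x. (- inverse (c k)) * (f k - (\<lambda>x. c k * b x)) x) \<in> real_fun.span B" for k
      by (rule real_fun.span_scale[OF c])
    moreover have "(\<lambda>k. (- inverse (c k)) * (f k - (\<lambda>x. c k * b x)) x) \<longlonglongrightarrow> b x" for x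
    proof -
      have "(\<lambda>k. inverse (c k)) \<longlonglongrightarrow> 0"
        by (rule filterlim_compose[OF tendsto_inverse_0 True])
      then have "(\<lambda>k. b x - inverse (c k) * f k x) \<longlonglongrightarrow> b x - 0 * g x"
        using insert.prems(2) by (intro tendsto_intros)
      moreover have "eventually (\<lambda>k. c k \<noteq> 0) sequentially"
        using True by (rule filterlim_at_infinity_imp_eventually_ne)
      then have "eventually (\<lambda>k. b x - inverse (c k) * f k x =
          (- inverse (c k)) * (f k - (\<lambda>x. c k * b x)) x) sequentially"
        by eventually_elim (simp add: field_simps)
      ultimately show ?thesis by (simp add: tendsto_cong)
    qed
    ultimately have b: "b \<in> real_fun.span B" by (rule insert.IH)
    then have eq: "real_fun.span (insert b B) = real_fun.span B"
      by (rule real_fun.span_redundant)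
    show ?thesis unfolding eq
      by (rule insert.IH[OF insert.prems(1)[unfolded eq] insert.prems(2)])
  next
    case False
    then obtain r where "\<not> eventually (\<lambda>k. r \<le> norm (c k)) sequentially"
      using filterlim_at_infinity[of 0 c sequentially] by auto
    then have inf: "infinite {k. \<bar>c k\<bar> < r}"
      by (auto simp: eventually_sequentially infinite_nat_iff_unbounded_le not_le)
    define e where "e = enumerate {k. \<bar>c k\<bar> < r}"
    have e: "strict_mono e" "\<bar>c (e k)\<bar> < r" for k
      using inf enumerate_in_set[OF inf] by (auto simp: e_def strict_mono_enumerate)
    have "bounded (range (c \<circ> e))"
      using e(2) by (intro boundedI[of _ r]) (auto simp: less_imp_le)
    then obtain l s where s: "strict_mono (s::nat \<Rightarrow> nat)" "((c \<circ> e) \<circ> s) \<longlonglongrightarrow> l"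
      using bounded_imp_convergent_subsequence by blast
    have "g - (\<lambda>x. l * b x) \<in> real_fun.span B"
    proof (rule insert.IH)
      show "f (e (s k)) - (\<lambda>x. c (e (s k)) * b x) \<in> real_fun.span B" for k by (rule c)
      show "(\<lambda>k. (f (e (s k)) - (\<lambda>x. c (e (s k)) * b x)) x) \<longlonglongrightarrow> (g - (\<lambda>x. l * b x)) x" for x
      proof -
        have "(\<lambda>k. f (e (s k)) x) \<longlonglongrightarrow> g x"
          using LIMSEQ_subseq_LIMSEQ[OF insert.prems(2), of "e \<circ> s"] e(1) s(1)
          by (simp add: o_def strict_mono_def)
        then show ?thesis using s(2) by (auto simp: o_def intro!: tendsto_intros)
      qed
    qed
    then show ?thesis unfolding real_fun.span_insert by blast
  qed
qed

section \<open>Second derivatives along the coordinate axes\<close>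

text \<open>
  The maximum principle needs only first and second derivatives along the axes. Unlike the
  regularity in the definition of ancient solutions, their existence passes to translates,
  reflections and linear combinations by a one-line argument, since \<open>f1\<close> and \<open>f2\<close> are explicit.
\<close>

definition axis_derivs ::
    "(real^'n \<Rightarrow> real) \<Rightarrow> ('n \<Rightarrow> real^'n \<Rightarrow> real) \<Rightarrow> ('n \<Rightarrow> real^'n \<Rightarrow> real) \<Rightarrow> bool" where
  "axis_derivs f f1 f2 \<longleftrightarrow>
    (\<forall>x i. ((\<lambda>s. f (x + s *\<^sub>R axis i 1)) has_real_derivative f1 i x) (at 0) \<and>
           ((\<lambda>s. f1 i (x + s *\<^sub>R axis i 1)) has_real_derivative f2 i x) (at 0))"

definition twice_axis_differentiable :: "(real^'n \<Rightarrow> real) \<Rightarrow> bool" where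
  "twice_axis_differentiable f \<longleftrightarrow> (\<exists>f1 f2. axis_derivs f f1 f2)"

lemma axis_derivs_along:
  assumes "axis_derivs f f1 f2"
  shows "((\<lambda>s. f (x + s *\<^sub>R axis i 1)) has_real_derivative f1 i (x + s *\<^sub>R axis i 1)) (at s)"
    and "((\<lambda>s. f1 i (x + s *\<^sub>R axis i 1)) has_real_derivative f2 i (x + s *\<^sub>R axis i 1)) (at s)"
proof -
  have "((\<lambda>r. f ((x + s *\<^sub>R axis i 1) + r *\<^sub>R axis i 1)) has_real_derivative
      f1 i (x + s *\<^sub>R axis i 1)) (at 0)"
    "((\<lambda>r. f1 i ((x + s *\<^sub>R axis i 1) + r *\<^sub>R axis i 1)) has_real_derivative
      f2 i (x + s *\<^sub>R axis i 1)) (at 0)"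
    using assms by (auto simp: axis_derivs_def)
  then have "((\<lambda>r. f (x + (r + s) *\<^sub>R axis i 1)) has_real_derivative
      f1 i (x + s *\<^sub>R axis i 1)) (at 0)"
    "((\<lambda>r. f1 i (x + (r + s) *\<^sub>R axis i 1)) has_real_derivative
      f2 i (x + s *\<^sub>R axis i 1)) (at 0)"
    by (simp_all add: algebra_simps)
  then show "((\<lambda>s. f (x + s *\<^sub>R axis i 1)) has_real_derivative f1 i (x + s *\<^sub>R axis i 1)) (at s)"
    and "((\<lambda>s. f1 i (x + s *\<^sub>R axis i 1)) has_real_derivative f2 i (x + s *\<^sub>R axis i 1)) (at s)"
    using DERIV_shift[of "\<lambda>s. f (x + s *\<^sub>R axis i 1)" _ 0 s]
      DERIV_shift[of "\<lambda>s. f1 i (x + s *\<^sub>R axis i 1)" _ 0 s] by simp_all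
qed

lemma laplacian_eq_sum:
  assumes "axis_derivs f f1 f2"
  shows "laplacian f x = (\<Sum>i\<in>UNIV. f2 i x)"
proof -
  have "(deriv ^^ 2) (\<lambda>s. f (x + s *\<^sub>R axis i 1)) 0 = f2 i x" for i
  proof -
    have "deriv (\<lambda>s. f (x + s *\<^sub>R axis i 1)) = (\<lambda>s. f1 i (x + s *\<^sub>R axis i 1))"
      using axis_derivs_along(1)[OF assms] by (auto simp: fun_eq_iff intro!: DERIV_imp_deriv)
    moreover have "deriv (\<lambda>s. f1 i (x + s *\<^sub>R axis i 1)) 0 = f2 i x"
      using axis_derivs_along(2)[OF assms, of i x 0] by (auto intro!: DERIV_imp_deriv)
    ultimately show ?thesis by (simp add: numeral_2_eq_2)
  qed
  then show ?thesis by (simp add: laplacian_def)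
qed

lemma axis_derivs_lincomb:
  assumes "axis_derivs f f1 f2" "axis_derivs g g1 g2"
  shows "axis_derivs (\<lambda>x. a * f x + b * g x) (\<lambda>i x. a * f1 i x + b * g1 i x)
    (\<lambda>i x. a * f2 i x + b * g2 i x)"
  using assms by (auto simp: axis_derivs_def intro!: DERIV_add DERIV_cmult)

lemma axis_derivs_translate:
  fixes f :: "real^'n \<Rightarrow> real"
  assumes "axis_derivs f f1 f2"
  shows "axis_derivs (\<lambda>x. f (x + a)) (\<lambda>i x. f1 i (x + a)) (\<lambda>i x. f2 i (x + a))"
proof -
  have eq: "x + s *\<^sub>R axis i 1 + a = (x + a) + s *\<^sub>R axis i 1" for x s and i :: 'n
    by (simp add: algebra_simps)
  show ?thesis using assms unfolding axis_derivs_def eq by blast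
qed

lemma axis_derivs_frechet:
  assumes "\<And>x. (f has_derivative f' x) (at x)"
    and "\<And>i x. ((\<lambda>x. f' x (axis i 1)) has_derivative f'' i x) (at x)"
  shows "axis_derivs f (\<lambda>i x. f' x (axis i 1)) (\<lambda>i x. f'' i x (axis i 1))"
proof -
  have line: "((\<lambda>s. h (x + s *\<^sub>R axis i 1)) has_real_derivative h' (axis i 1)) (at 0)"
    if h: "(h has_derivative h') (at x)" for h :: "real^'n \<Rightarrow> real" and h' x and i :: 'n
  proof -
    have h0: "(h has_derivative h') (at (x + 0 *\<^sub>R axis i 1))" using h by simp
    have "((\<lambda>s. h (x + s *\<^sub>R axis i 1)) has_derivative (\<lambda>s. h' (s *\<^sub>R axis i 1))) (at 0)"
      by (rule has_derivative_compose[of "\<lambda>s. x + s *\<^sub>R axis i 1" "\<lambda>s. s *\<^sub>R axis i 1" 0 UNIV h h', OF _ h0])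
        (auto intro!: derivative_eq_intros)
    moreover have "(\<lambda>s. h' (s *\<^sub>R axis i 1)) = (\<lambda>s. s * h' (axis i 1))"
      using has_derivative_bounded_linear[OF h] by (auto simp: linear_simps)
    moreover have "(\<lambda>s. s * h' (axis i 1)) = (*) (h' (axis i 1))" by (simp add: fun_eq_iff)
    ultimately show ?thesis unfolding has_field_derivative_def by metis
  qed
  show ?thesis unfolding axis_derivs_def using line assms by blast
qed

lemma laplacian_lincomb:
  assumes "twice_axis_differentiable f" "twice_axis_differentiable g"
  shows "twice_axis_differentiable (\<lambda>x. a * f x + b * g x)"
    and "laplacian (\<lambda>x. a * f x + b * g x) x = a * laplacian f x + b * laplacian g x"
proof -
  obtain f1 f2 g1 g2 where *: "axis_derivs f f1 f2" "axis_derivs g g1 g2"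
    using assms by (auto simp: twice_axis_differentiable_def)
  show "twice_axis_differentiable (\<lambda>x. a * f x + b * g x)"
    using axis_derivs_lincomb[OF *] unfolding twice_axis_differentiable_def by blast
  show "laplacian (\<lambda>x. a * f x + b * g x) x = a * laplacian f x + b * laplacian g x"
    using laplacian_eq_sum[OF axis_derivs_lincomb[OF *], of a b x]
      laplacian_eq_sum[OF *(1)] laplacian_eq_sum[OF *(2)]
    by (simp add: sum.distrib sum_distrib_left)
qed

lemma laplacian_translate:
  assumes "twice_axis_differentiable f"
  shows "twice_axis_differentiable (\<lambda>x. f (x + a))"
    and "laplacian (\<lambda>x. f (x + a)) x = laplacian f (x + a)"
proof -
  obtain f1 f2 where *: "axis_derivs f f1 f2"
    using assms by (auto simp: twice_axis_differentiable_def)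
  show "twice_axis_differentiable (\<lambda>x. f (x + a))"
    using axis_derivs_translate[OF *] unfolding twice_axis_differentiable_def by blast
  show "laplacian (\<lambda>x. f (x + a)) x = laplacian f (x + a)"
    using laplacian_eq_sum[OF axis_derivs_translate[OF *]] laplacian_eq_sum[OF *] by simp
qed

lemma laplacian_zero: "twice_axis_differentiable (\<lambda>x. 0)" "laplacian (\<lambda>x. 0) x = 0"
proof -
  have *: "axis_derivs (\<lambda>x. 0) (\<lambda>i x. 0) (\<lambda>i x. 0)" by (simp add: axis_derivs_def)
  then show "twice_axis_differentiable (\<lambda>x. 0)" unfolding twice_axis_differentiable_def by blast
  show "laplacian (\<lambda>x. 0) x = 0" using laplacian_eq_sum[OF *] by simp
qed

lemma laplacian_sum:
  assumes "\<And>j. j \<in> J \<Longrightarrow> twice_axis_differentiable (f j)"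
  shows "twice_axis_differentiable (\<lambda>x. \<Sum>j\<in>J. c j * f j x) \<and>
    laplacian (\<lambda>x. \<Sum>j\<in>J. c j * f j x) x = (\<Sum>j\<in>J. c j * laplacian (f j) x)"
  using assms
proof (induction J rule: infinite_finite_induct)
  case (insert j J)
  then show ?case
    using laplacian_lincomb[of "f j" "\<lambda>x. \<Sum>j\<in>J. c j * f j x" "c j" 1] by simp
qed (simp_all add: laplacian_zero)

section \<open>Smoothness of polynomial functions\<close>

lemma Ck_on_cong:
  assumes "Ck_on k S f" "\<And>x. x \<in> S \<Longrightarrow> f x = g x"
  shows "Ck_on k S g"
proof (cases k)
  case 0
  then show ?thesis using assms continuous_on_cong[of S S f g] by simp
next
  case (Suc l)
  then obtain f' where "\<forall>x\<in>S. (f has_derivative f' x) (at x within S)"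
    "\<forall>v. Ck_on l S (\<lambda>x. f' x v)" using assms(1) by auto
  moreover have "(g has_derivative f' x) (at x within S)"
    if "x \<in> S" "(f has_derivative f' x) (at x within S)" for x
    by (rule has_derivative_transform[OF that(1) _ that(2)]) (simp add: assms(2))
  ultimately show ?thesis using Suc by (auto intro!: exI[of _ f'])
qed

text \<open>
  Real polynomial functions form a class closed under directional derivatives; the differentiability
  of every order required by \<open>Ck_on\<close> follows by induction.
\<close>

lemma real_polynomial_function_has_derivative:
  assumes "real_polynomial_function f"
  shows "\<exists>f'. (\<forall>x. (f has_derivative f' x) (at x)) \<and> (\<forall>v. real_polynomial_function (\<lambda>x. f' x v))"
  using assms
proof induction
  case (linear f)
  then show ?case
    by (intro exI[of _ "\<lambda>x. f"] conjI allI bounded_linear_imp_has_derivative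
        real_polynomial_function.intros(2))
next
  case (const c)
  show ?case
    by (intro exI[of _ "\<lambda>x v. 0"] conjI allI has_derivative_const
        real_polynomial_function.intros(2))
next
  case (add f g)
  then obtain f' g' where
    "\<forall>x. (f has_derivative f' x) (at x)" "\<forall>v. real_polynomial_function (\<lambda>x. f' x v)"
    "\<forall>x. (g has_derivative g' x) (at x)" "\<forall>v. real_polynomial_function (\<lambda>x. g' x v)" by blast
  then show ?case
    by (intro exI[of _ "\<lambda>x v. f' x v + g' x v"] conjI allI has_derivative_add
        real_polynomial_function.intros(3)) simp_all
next
  case (mult f g)
  then obtain f' g' where
    "\<forall>x. (f has_derivative f' x) (at x)" "\<forall>v. real_polynomial_function (\<lambda>x. f' x v)"
    "\<forall>x. (g has_derivative g' x) (at x)" "\<forall>v. real_polynomial_function (\<lambda>x. g' x v)" by blast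
  then show ?case using mult.hyps
    by (intro exI[of _ "\<lambda>x v. f x * g' x v + f' x v * g x"] conjI allI has_derivative_mult
        real_polynomial_function.intros(3) real_polynomial_function.intros(4)) simp_all
qed

lemma real_polynomial_function_Ck_on:
  assumes "real_polynomial_function f"
  shows "Ck_on k S f"
  using assms
proof (induction k arbitrary: f)
  case 0
  obtain f' where "\<And>x. (f has_derivative f' x) (at x)"
    using real_polynomial_function_has_derivative[OF 0] by blast
  then have "continuous_on S f"
    by (rule has_derivative_continuous_on[OF has_derivative_at_withinI])
  then show ?case by simp
next
  case (Suc k)
  obtain f' where f': "\<And>x. (f has_derivative f' x) (at x)"
    "\<And>v. real_polynomial_function (\<lambda>x. f' x v)"
    using real_polynomial_function_has_derivative[OF Suc.prems] by blast
  have "\<forall>x\<in>S. (f has_derivative f' x) (at x within S)"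
    using f'(1) by (blast intro: has_derivative_at_withinI)
  moreover have "\<forall>v. Ck_on k S (\<lambda>x. f' x v)" using Suc.IH[OF f'(2)] by blast
  ultimately show ?case unfolding Ck_on.simps by (intro exI[of _ f'] conjI)
qed

lemma real_polynomial_function_twice_axis_differentiable:
  assumes "real_polynomial_function f"
  shows "twice_axis_differentiable f"
proof -
  obtain f' where f': "\<And>x. (f has_derivative f' x) (at x)"
    "\<And>v. real_polynomial_function (\<lambda>x. f' x v)"
    using real_polynomial_function_has_derivative[OF assms] by blast
  have "\<exists>g. \<forall>x. ((\<lambda>x. f' x (axis i 1)) has_derivative g x) (at x)" for i
    using real_polynomial_function_has_derivative[OF f'(2)[of "axis i 1"]] by (elim exE conjE exI)
  then have "\<forall>i. \<exists>g. \<forall>x. ((\<lambda>x. f' x (axis i 1)) has_derivative g x) (at x)" ..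
  from choice[OF this] obtain f'' where
    "\<forall>i x. ((\<lambda>x. f' x (axis i 1)) has_derivative f'' i x) (at x)" ..
  then have "axis_derivs f (\<lambda>i x. f' x (axis i 1)) (\<lambda>i x. f'' i x (axis i 1))"
    by (intro axis_derivs_frechet f') simp
  then show ?thesis unfolding twice_axis_differentiable_def by (intro exI)
qed

section \<open>Polynomials of bounded degree and the Laplacian\<close>

definition monomial :: "('n \<Rightarrow> nat) \<Rightarrow> real^'n \<Rightarrow> real" where
  "monomial a x = (\<Prod>i\<in>UNIV. (x $ i) ^ a i)"

definition polys :: "nat \<Rightarrow> (real^'n \<Rightarrow> real) set" where
  "polys m = real_fun.span (monomial ` {a. sum a UNIV \<le> m})"

lemma finite_multi_indices: "finite {a :: 'n::finite \<Rightarrow> nat. sum a UNIV \<le> m}"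
proof (rule finite_subset)
  show "{a. sum a UNIV \<le> m} \<subseteq> PiE UNIV (\<lambda>_::'n. {..m})"
  proof
    fix a :: "'n \<Rightarrow> nat" assume a: "a \<in> {a. sum a UNIV \<le> m}"
    have "a i \<le> m" for i using member_le_sum[of i UNIV a] a by simp
    then show "a \<in> PiE UNIV (\<lambda>_. {..m})" by auto
  qed
  show "finite (PiE UNIV (\<lambda>_::'n. {..m}))" by (intro finite_PiE) auto
qed

lemma subspace_polys: "real_fun.subspace (polys m)"
  by (simp add: polys_def)

lemma polys_induct [consumes 1, case_names zero step]:
  assumes "p \<in> polys m" "P (\<lambda>x. 0)"
    and "\<And>c a q. sum a UNIV \<le> m \<Longrightarrow> q \<in> polys m \<Longrightarrow> P q \<Longrightarrow> P (\<lambda>x. c * monomial a x + q x)"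
  shows "P p"
proof -
  have "p \<in> real_fun.span (monomial ` {a. sum a UNIV \<le> m})"
    using assms(1) by (simp only: polys_def)
  then have "p \<in> polys m \<and> P p"
  proof (induction rule: real_fun.span_induct_alt)
    case base
    then show ?case
      using assms(2) real_fun.subspace_0[OF subspace_polys, of m] unfolding zero_fun_def by blast
  next
    case (step c b q)
    then obtain a where a: "b = monomial a" "sum a UNIV \<le> m" by auto
    have b: "b \<in> polys m" unfolding a(1) polys_def
      by (rule real_fun.span_base) (simp add: a(2))
    have q: "q \<in> polys m" "P q" using step(2) by auto
    have "(\<lambda>x. c * b x) + q \<in> polys m"
      by (rule real_fun.subspace_add[OF subspace_polys
          real_fun.subspace_scale[OF subspace_polys b] q(1)])
    moreover have "P ((\<lambda>x. c * b x) + q)"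
      using assms(3)[OF a(2) q, of c] unfolding a(1) plus_fun_def .
    ultimately show ?case ..
  qed
  then show ?thesis ..
qed

lemma polys_lincomb:
  assumes "p \<in> polys m" "q \<in> polys m"
  shows "(\<lambda>x. a * p x + b * q x) \<in> polys m"
proof -
  have "(\<lambda>x. a * p x) + (\<lambda>x. b * q x) \<in> polys m"
    by (rule real_fun.subspace_add[OF subspace_polys
        real_fun.subspace_scale[OF subspace_polys assms(1)]
        real_fun.subspace_scale[OF subspace_polys assms(2)]])
  then show ?thesis by (simp only: plus_fun_def)
qed

lemma polys_scale: "p \<in> polys m \<Longrightarrow> (\<lambda>x. a * p x) \<in> polys m"
  by (rule real_fun.subspace_scale[OF subspace_polys])

lemma polys_zero: "(\<lambda>x. 0) \<in> polys m"
  using real_fun.subspace_0[OF subspace_polys, of m] by (simp add: zero_fun_def)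

lemma polys_sum: "(\<And>j. j \<in> J \<Longrightarrow> p j \<in> polys m) \<Longrightarrow> (\<lambda>x. \<Sum>j\<in>J. p j x) \<in> polys m"
proof (induction J rule: infinite_finite_induct)
  case (insert j J)
  then have "p j \<in> polys m" "(\<lambda>x. \<Sum>j\<in>J. p j x) \<in> polys m" by blast+
  from polys_lincomb[OF this, of 1 1] insert.hyps show ?case by simp
qed (simp_all add: polys_zero)

lemma monomial_in_polys: "sum a UNIV \<le> m \<Longrightarrow> monomial a \<in> polys m"
  by (auto simp: polys_def intro!: real_fun.span_base)

lemma const_in_polys: "(\<lambda>x. c) \<in> polys m"
  using polys_scale[OF monomial_in_polys[of "\<lambda>_. 0" m], of c] by (simp add: monomial_def)

lemma monomial_update:
  "monomial (a(i := k)) x = (x $ i) ^ k * (\<Prod>j\<in>UNIV - {i}. (x $ j) ^ a j)"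
proof -
  have "(\<Prod>j\<in>UNIV - {i}. (x $ j) ^ (a(i := k)) j) = (\<Prod>j\<in>UNIV - {i}. (x $ j) ^ a j)"
    by (rule prod.cong) auto
  then show ?thesis unfolding monomial_def by (subst prod.remove[of _ i]) auto
qed

lemma sum_update: "sum (a(i := k)) UNIV + a i = sum a UNIV + (k::nat)" for i :: "'n::finite"
proof -
  have "sum (a(i := k)) (UNIV - {i}) = sum a (UNIV - {i})"
    by (rule sum.cong) auto
  then show ?thesis by (simp add: sum.remove[of UNIV i])
qed

lemma mult_coord_monomial: "x $ i * monomial a x = monomial (a(i := Suc (a i))) x"
  using monomial_update[of a i "a i" x] by (simp add: monomial_update)

lemma polys_mult_coord:
  assumes "p \<in> polys m"
  shows "(\<lambda>x. x $ i * p x) \<in> polys (Suc m)"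
  using assms
proof (induction rule: polys_induct)
  case zero
  then show ?case by (simp add: polys_zero)
next
  case (step c a q)
  have "sum (a(i := Suc (a i))) UNIV \<le> Suc m" using sum_update[of a i "Suc (a i)"] step by simp
  from polys_lincomb[OF monomial_in_polys[OF this] step.IH, of c 1]
  have "(\<lambda>x. c * (x $ i * monomial a x) + x $ i * q x) \<in> polys (Suc m)"
    by (simp only: mult_coord_monomial mult_1)
  moreover have "c * (x $ i * monomial a x) + x $ i * q x = x $ i * (c * monomial a x + q x)" for x
    by (simp only: distrib_left mult.left_commute)
  ultimately show ?case by (simp only:)
qed

lemma real_polynomial_function_monomial: "real_polynomial_function (monomial a)"
  unfolding monomial_def
  by (intro real_polynomial_function_prod real_polynomial_function_power
      real_polynomial_function.intros(1) bounded_linear_vec_nth) simp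

lemma real_polynomial_function_polys:
  assumes "p \<in> polys m" shows "real_polynomial_function p"
  using assms
proof (induction rule: polys_induct)
  case zero
  show ?case by (rule real_polynomial_function.intros(2))
next
  case (step c a q)
  then show ?case using real_polynomial_function_monomial[of a]
    by (intro real_polynomial_function.intros(2-4)) simp_all
qed

lemma axis_derivs_monomial:
  "axis_derivs (monomial a) (\<lambda>i x. real (a i) * monomial (a(i := a i - 1)) x)
    (\<lambda>i x. real (a i) * real (a i - 1) * monomial (a(i := a i - 2)) x)"
proof -
  have D: "((\<lambda>s. monomial a (x + s *\<^sub>R axis i 1)) has_real_derivative
      real (a i) * monomial (a(i := a i - 1)) x) (at 0)" for a :: "'n::finite \<Rightarrow> nat" and x i
  proof -
    have "monomial a (x + s *\<^sub>R axis i 1) =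
        (x $ i + s) ^ a i * (\<Prod>j\<in>UNIV - {i}. (x $ j) ^ a j)" for s
    proof -
      have "(\<Prod>j\<in>UNIV - {i}. ((x + s *\<^sub>R axis i 1) $ j) ^ a j) =
          (\<Prod>j\<in>UNIV - {i}. (x $ j) ^ a j)"
        by (rule prod.cong) (auto simp: axis_def)
      then show ?thesis
        using monomial_update[of a i "a i" "x + s *\<^sub>R axis i 1"] by (simp add: axis_def)
    qed
    moreover have "((\<lambda>s. (x $ i + s) ^ a i * (\<Prod>j\<in>UNIV - {i}. (x $ j) ^ a j)) has_real_derivative
        real (a i) * (x $ i + 0) ^ (a i - 1) * (\<Prod>j\<in>UNIV - {i}. (x $ j) ^ a j)) (at 0)"
      by (rule derivative_eq_intros refl)+ simp
    ultimately show ?thesis by (simp add: monomial_update mult.assoc)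
  qed
  have "((\<lambda>s. real (a i) * monomial (a(i := a i - 1)) (x + s *\<^sub>R axis i 1)) has_real_derivative
      real (a i) * real (a i - 1) * monomial (a(i := a i - 2)) x) (at 0)" for x i
    using DERIV_cmult[OF D[of "a(i := a i - 1)" x i], of "real (a i)"]
    by (simp add: mult.assoc numeral_2_eq_2)
  then show ?thesis using D unfolding axis_derivs_def by blast
qed

lemma laplacian_monomial:
  "laplacian (monomial a) x =
    (\<Sum>i\<in>UNIV. real (a i) * real (a i - 1) * monomial (a(i := a i - 2)) x)"
  by (rule laplacian_eq_sum[OF axis_derivs_monomial])

lemma polys_twice_axis_differentiable: "p \<in> polys m \<Longrightarrow> twice_axis_differentiable p"
  using real_polynomial_function_polys real_polynomial_function_twice_axis_differentiable by blast

lemma laplacian_polys_lincomb: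
  assumes "p \<in> polys m" "q \<in> polys m"
  shows "laplacian (\<lambda>x. a * p x + b * q x) = (\<lambda>x. a * laplacian p x + b * laplacian q x)"
  by (rule ext) (rule laplacian_lincomb(2)[OF assms[THEN polys_twice_axis_differentiable]])

lemma laplacian_in_polys:
  fixes p :: "real^'n \<Rightarrow> real"
  assumes "p \<in> polys (m + 2)"
  shows "laplacian p \<in> polys m"
  using assms
proof (induction rule: polys_induct)
  case zero
  have "laplacian (\<lambda>x. 0) = (\<lambda>x :: real^'n. 0)" by (rule ext) (rule laplacian_zero)
  then show ?case by (simp only: polys_zero)
next
  case (step c a q)
  have "(\<lambda>x. real (a i) * real (a i - 1) * monomial (a(i := a i - 2)) x) \<in> polys m" for i
  proof (cases "a i < 2")
    case True
    then have "real (a i) * real (a i - 1) = 0" by auto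
    then show ?thesis by (simp only: mult_zero_left polys_zero)
  next
    case False
    then show ?thesis using sum_update[of a i "a i - 2"] step.hyps(1)
      by (intro polys_scale monomial_in_polys) simp
  qed
  then have "laplacian (monomial a) \<in> polys m"
    unfolding laplacian_monomial[abs_def] by (rule polys_sum)
  from polys_lincomb[OF this step.IH, of c 1] show ?case
    using laplacian_polys_lincomb[OF monomial_in_polys[OF step.hyps(1)] step.hyps(2), of c 1]
    by (simp only: mult_1)
qed

lemma polys_0_eq: "p \<in> polys 0 \<Longrightarrow> \<exists>c. p = (\<lambda>x. c)"
proof (induction rule: polys_induct)
  case (step c a q)
  then obtain d where d: "q = (\<lambda>x. d)" by blast
  have "a i = 0" for i using step.hyps(1) by simp
  then have "(\<lambda>x. c * monomial a x + q x) = (\<lambda>x. c + d)"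
    unfolding d by (simp add: monomial_def)
  then show ?case by (rule exI)
next
  case zero
  show ?case by (rule exI) (rule refl)
qed

lemma laplacian_polys_0:
  assumes "p \<in> polys 0" shows "laplacian p = (\<lambda>x. 0)"
proof -
  obtain c where p: "p = (\<lambda>x. c)" using polys_0_eq[OF assms] by blast
  have "axis_derivs p (\<lambda>i x. 0) (\<lambda>i x. 0)" by (simp add: axis_derivs_def p)
  from laplacian_eq_sum[OF this] have "laplacian p x = 0" for x by simp
  then show ?thesis by (rule ext)
qed

text \<open>
  Monomials are hit by induction on their total degree in the variables other than a fixed one
  \<open>x\<^sub>i\<^sub>0\<close>: integrating \<open>x\<^sup>a\<close> twice in \<open>x\<^sub>i\<^sub>0\<close> gives a polynomial whose Laplacian is \<open>x\<^sup>a\<close> plus monomials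
  of the same total degree in which the other variables occur to lower degree.
\<close>

lemma laplacian_onto_polys: "laplacian ` polys (m + 2) = (polys m :: (real^'n \<Rightarrow> real) set)"
proof
  show "laplacian ` polys (m + 2) \<subseteq> (polys m :: (real^'n \<Rightarrow> real) set)"
    using laplacian_in_polys by blast
  let ?R = "laplacian ` polys (m + 2) :: (real^'n \<Rightarrow> real) set"
  have comb: "(\<lambda>x. a * f x + b * g x) \<in> ?R" if f: "f \<in> ?R" and g: "g \<in> ?R" for f g a b
  proof -
    obtain p q where "p \<in> polys (m + 2)" "q \<in> polys (m + 2)" "f = laplacian p" "g = laplacian q"
      using f g by blast
    then show ?thesis using laplacian_polys_lincomb[of p "m + 2" q a b] polys_lincomb[of p "m + 2" q a b]
      by (intro image_eqI[of _ _ "\<lambda>x. a * p x + b * q x"]) (simp_all only:)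
  qed
  have zero: "(\<lambda>x. 0) \<in> ?R"
    by (intro image_eqI[of _ _ "\<lambda>x. 0"] polys_zero ext) (simp add: laplacian_zero)
  \<comment> \<open>Index types are nonempty, so there is a coordinate to integrate in.\<close>
  obtain i0 :: 'n where True by blast
  have mono: "monomial a \<in> ?R" if "sum a UNIV \<le> m" for a :: "'n \<Rightarrow> nat"
    using that
  proof (induction "sum a (UNIV - {i0})" arbitrary: a rule: less_induct)
    case less
    define b where "b = a(i0 := a i0 + 2)"
    define c where "c = real (a i0 + 2) * real (a i0 + 1)"
    define rest where "rest j x = real (a j) * real (a j - 1) * monomial (b(j := a j - 2)) x" for j x
    have b: "sum b UNIV \<le> m + 2" using sum_update[of a i0 "a i0 + 2"] less.prems by (simp add: b_def)
    have rest: "rest j \<in> ?R" if j: "j \<noteq> i0" for j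
    proof (cases "a j < 2")
      case True
      then have "rest j = (\<lambda>x. 0)" by (auto simp: rest_def)
      then show ?thesis using zero by simp
    next
      case False
      have "sum (b(j := a j - 2)) UNIV \<le> m"
        using sum_update[of b j "a j - 2"] b j False by (simp add: b_def)
      moreover have "sum (b(j := a j - 2)) (UNIV - {i0}) < sum a (UNIV - {i0})"
        using False j by (intro sum_strict_mono_ex1) (auto simp: b_def)
      ultimately have "monomial (b(j := a j - 2)) \<in> ?R" by (intro less.hyps) auto
      from comb[OF this zero, of "real (a j) * real (a j - 1)" 0] show ?thesis
        by (simp add: rest_def[abs_def])
    qed
    have sum_rest: "(\<lambda>x. \<Sum>j\<in>J. rest j x) \<in> ?R" if "i0 \<notin> J" for J
      using finite[of J] that
    proof (induction rule: finite_induct)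
      case (insert j J)
      then have "rest j \<in> ?R" "(\<lambda>x. \<Sum>j\<in>J. rest j x) \<in> ?R" using rest by auto
      from comb[OF this, of 1 1] insert.hyps show ?case by simp
    qed (use zero in simp)
    have "monomial a x = inverse c * laplacian (monomial b) x +
        (- inverse c) * (\<Sum>j\<in>UNIV - {i0}. rest j x)" for x
    proof -
      have "laplacian (monomial b) x = c * monomial a x + (\<Sum>j\<in>UNIV - {i0}. rest j x)"
      proof -
        have "b(i0 := b i0 - 2) = a" by (auto simp: b_def)
        then have "real (b i0) * real (b i0 - 1) * monomial (b(i0 := b i0 - 2)) x = c * monomial a x"
          by (simp add: b_def c_def)
        moreover have "(\<Sum>j\<in>UNIV - {i0}. real (b j) * real (b j - 1) * monomial (b(j := b j - 2)) x) =
            (\<Sum>j\<in>UNIV - {i0}. rest j x)"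
          by (rule sum.cong) (auto simp: b_def rest_def)
        ultimately show ?thesis
          unfolding laplacian_monomial by (subst sum.remove[of _ i0]) auto
      qed
      moreover have "c \<noteq> 0" by (simp add: c_def)
      ultimately show ?thesis by (simp add: distrib_left mult.assoc[symmetric])
    qed
    then have "monomial a = (\<lambda>x. inverse c * laplacian (monomial b) x +
        (- inverse c) * (\<Sum>j\<in>UNIV - {i0}. rest j x))" by (rule ext)
    also have "\<dots> \<in> ?R"
      using monomial_in_polys[OF b] sum_rest[of "UNIV - {i0}"] by (intro comb) auto
    finally show ?case .
  qed
  show "polys m \<subseteq> ?R"
  proof
    fix p :: "real^'n \<Rightarrow> real" assume "p \<in> polys m"
    then show "p \<in> ?R"
    proof (induction rule: polys_induct)
      case (step c a q)
      from comb[OF mono[OF step.hyps(1)] step.IH, of c 1] show ?case by (simp only: mult_1)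
    qed (rule zero)
  qed
qed

section \<open>Growth, primitives and differences of polynomials\<close>

lemma polys_growth:
  fixes p :: "real^'n \<Rightarrow> real"
  assumes "p \<in> polys m"
  shows "\<exists>C\<ge>0. \<forall>x. \<bar>p x\<bar> \<le> C * (1 + norm x) ^ m"
  using assms
proof (induction rule: polys_induct)
  case zero
  show ?case by (intro exI[of _ 0]) simp
next
  case (step c a q)
  then obtain C where C: "C \<ge> 0" "\<And>x. \<bar>q x\<bar> \<le> C * (1 + norm x) ^ m" by blast
  have mono: "\<bar>monomial a x\<bar> \<le> (1 + norm x) ^ m" for x
  proof -
    have "\<bar>monomial a x\<bar> = (\<Prod>i\<in>UNIV. \<bar>x $ i\<bar> ^ a i)"
      by (simp add: monomial_def abs_prod power_abs)
    also have "\<dots> \<le> (\<Prod>i\<in>UNIV. (1 + norm x) ^ a i)"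
      using component_le_norm_cart[of x]
      by (intro prod_mono conjI power_mono) (auto simp: add_increasing)
    also have "\<dots> = (1 + norm x) ^ sum a UNIV" by (simp add: power_sum)
    also have "\<dots> \<le> (1 + norm x) ^ m" by (intro power_increasing step.hyps) simp
    finally show ?thesis .
  qed
  have "\<bar>c * monomial a x + q x\<bar> \<le> (\<bar>c\<bar> + C) * (1 + norm x) ^ m" for x
  proof -
    have "\<bar>c * monomial a x + q x\<bar> \<le> \<bar>c\<bar> * \<bar>monomial a x\<bar> + \<bar>q x\<bar>"
      by (simp add: abs_mult[symmetric])
    also have "\<dots> \<le> \<bar>c\<bar> * (1 + norm x) ^ m + C * (1 + norm x) ^ m"
      by (intro add_mono mult_left_mono mono C) simp
    finally show ?thesis by (simp add: distrib_right)
  qed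
  then show ?case using C(1) by (intro exI[of _ "\<bar>c\<bar> + C"]) simp
qed

lemma monomial_scale: "monomial a (s *\<^sub>R x) = s ^ sum a UNIV * monomial a x"
  by (simp add: monomial_def power_mult_distrib prod.distrib power_sum)

text \<open>
  With the integral over \<open>0 \<le> r \<le> 1\<close>, this is \<open>Q x = \<integral> q (r x) dr\<close>. For a monomial \<open>q\<close> of degree \<open>N\<close> it is just \<open>q / (N + 1)\<close>, which
  keeps \<open>Q\<close> in the same space.
\<close>

lemma polys_radial_primitive:
  fixes q :: "real^'n \<Rightarrow> real"
  assumes "q \<in> polys m"
  shows "\<exists>Q\<in>polys m. \<forall>x s.
    ((\<lambda>s. s * Q (s *\<^sub>R x)) has_real_derivative q (s *\<^sub>R x)) (at s)"
  using assms
proof (induction rule: polys_induct)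
  case zero
  show ?case by (intro bexI[of _ "\<lambda>x. 0"] polys_zero) simp
next
  case (step c a q)
  then obtain Q where Q: "Q \<in> polys m"
    "\<And>x s. ((\<lambda>s. s * Q (s *\<^sub>R x)) has_real_derivative q (s *\<^sub>R x)) (at s)" by blast
  define N where "N = sum a UNIV"
  define P where "P x = c / real (Suc N) * monomial a x + 1 * Q x" for x
  have "P \<in> polys m"
    unfolding P_def[abs_def] by (rule polys_lincomb[OF monomial_in_polys[OF step.hyps(1)] Q(1)])
  moreover have "((\<lambda>s. s * P (s *\<^sub>R x)) has_real_derivative
      c * monomial a (s *\<^sub>R x) + q (s *\<^sub>R x)) (at s)" for x s
  proof -
    have "((\<lambda>s. s ^ Suc N) has_real_derivative real (Suc N) * s ^ N) (at s)"
      using DERIV_pow[of "Suc N" s UNIV] by simp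
    then have "((\<lambda>s. c / real (Suc N) * monomial a x * s ^ Suc N) has_real_derivative
        c / real (Suc N) * monomial a x * (real (Suc N) * s ^ N)) (at s)"
      by (rule DERIV_cmult)
    from DERIV_add[OF this Q(2)[of x s]]
    have "((\<lambda>s. c / real (Suc N) * monomial a x * s ^ Suc N + s * Q (s *\<^sub>R x)) has_real_derivative
        c / real (Suc N) * monomial a x * (real (Suc N) * s ^ N) + q (s *\<^sub>R x)) (at s)" .
    moreover have "c / real (Suc N) * monomial a x * s ^ Suc N + s * Q (s *\<^sub>R x) =
        s * P (s *\<^sub>R x)" for s
      by (simp add: P_def monomial_scale N_def[symmetric] distrib_left)
    moreover have "c / real (Suc N) * monomial a x * (real (Suc N) * s ^ N) =
        c * monomial a (s *\<^sub>R x)"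
      by (simp add: monomial_scale N_def[symmetric])
    ultimately show ?thesis by (simp only:)
  qed
  ultimately show ?case by blast
qed

text \<open>
  Integration along rays: \<open>f x - f 0\<close> is the sum over \<open>i\<close> of \<open>x\<^sub>i\<close> times the radial primitive at \<open>x\<close> of
  the \<open>i\<close>-th partial derivative, because both sides have the same derivative along the ray through \<open>x\<close>.
\<close>

lemma polys_of_partials:
  fixes f :: "real^'n \<Rightarrow> real"
  assumes f: "\<And>x. (f has_derivative f' x) (at x)"
    and d: "\<And>i. (\<lambda>x. f' x (axis i 1)) \<in> polys m"
  shows "f \<in> polys (Suc m)"
proof -
  have "\<forall>i. \<exists>Q. Q \<in> polys m \<and> (\<forall>x s.
    ((\<lambda>s. s * Q (s *\<^sub>R x)) has_real_derivative f' (s *\<^sub>R x) (axis i 1)) (at s))"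
    using polys_radial_primitive[OF d] by blast
  from choice[OF this] obtain Q where Q: "\<And>i. Q i \<in> polys m"
    "\<And>i x s. ((\<lambda>s. s * Q i (s *\<^sub>R x)) has_real_derivative f' (s *\<^sub>R x) (axis i 1)) (at s)"
    by blast
  have "f x = f 0 + (\<Sum>i\<in>UNIV. x $ i * Q i x)" for x
  proof -
    define g where "g s = f (s *\<^sub>R x) - (\<Sum>i\<in>UNIV. x $ i * (s * Q i (s *\<^sub>R x)))" for s
    have "DERIV g s :> 0" for s
    proof -
      have "((\<lambda>s. f (s *\<^sub>R x)) has_derivative (\<lambda>h. f' (s *\<^sub>R x) (h *\<^sub>R x))) (at s)"
        by (rule has_derivative_compose[of "\<lambda>s. s *\<^sub>R x" "\<lambda>h. h *\<^sub>R x" s UNIV f, OF _ f])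
          (auto intro!: derivative_eq_intros)
      moreover have "f' (s *\<^sub>R x) (h *\<^sub>R x) = (\<Sum>i\<in>UNIV. x $ i * f' (s *\<^sub>R x) (axis i 1)) * h" for h
      proof -
        interpret L: bounded_linear "f' (s *\<^sub>R x)" by (rule has_derivative_bounded_linear[OF f])
        have "f' (s *\<^sub>R x) x = f' (s *\<^sub>R x) (\<Sum>i\<in>UNIV. (x $ i) *\<^sub>R axis i 1)"
          using basis_expansion[of x] by (simp add: scalar_mult_eq_scaleR)
        also have "\<dots> = (\<Sum>i\<in>UNIV. x $ i * f' (s *\<^sub>R x) (axis i 1))"
          by (simp add: L.sum L.scaleR)
        finally show ?thesis by (simp add: L.scaleR)
      qed
      ultimately have "((\<lambda>s. f (s *\<^sub>R x)) has_real_derivative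
          (\<Sum>i\<in>UNIV. x $ i * f' (s *\<^sub>R x) (axis i 1))) (at s)"
        by (simp only: has_field_derivative_def)
      then have "DERIV g s :> (\<Sum>i\<in>UNIV. x $ i * f' (s *\<^sub>R x) (axis i 1)) -
          (\<Sum>i\<in>UNIV. x $ i * f' (s *\<^sub>R x) (axis i 1))"
        unfolding g_def by (intro DERIV_diff DERIV_sum DERIV_cmult Q(2))
      then show ?thesis by simp
    qed
    then have "g 1 = g 0" by (intro DERIV_isconst_all) simp
    then show ?thesis by (simp add: g_def)
  qed
  then have "f = (\<lambda>x. 1 * f 0 + 1 * (\<Sum>i\<in>UNIV. x $ i * Q i x))"
    unfolding mult_1 by (rule ext)
  also have "\<dots> \<in> polys (Suc m)"
    by (intro polys_lincomb const_in_polys polys_sum polys_mult_coord Q(1))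
  finally show ?thesis .
qed

lemma central_difference_quotient_tendsto:
  assumes "(g has_real_derivative d) (at 0)"
  shows "(\<lambda>k. (g (inverse (real (Suc k))) - g (- inverse (real (Suc k)))) / (2 * inverse (real (Suc k))))
    \<longlonglongrightarrow> d"
proof -
  let ?h = "\<lambda>k. inverse (real (Suc k))"
  have q: "((\<lambda>s. (g s - g 0) / s) \<longlongrightarrow> d) (at 0)"
    using assms by (simp add: has_field_derivative_iff)
  have h: "?h \<longlonglongrightarrow> 0" by (rule LIMSEQ_inverse_real_of_nat)
  have "filterlim ?h (at 0) sequentially" "filterlim (\<lambda>k. - ?h k) (at 0) sequentially"
    using h tendsto_minus[OF h] by (auto simp: filterlim_at)
  then have "(\<lambda>k. (g (?h k) - g 0) / ?h k) \<longlonglongrightarrow> d" "(\<lambda>k. (g (- ?h k) - g 0) / (- ?h k)) \<longlonglongrightarrow> d"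
    using filterlim_compose[OF q] by blast+
  then have "(\<lambda>k. ((g (?h k) - g 0) / ?h k + (g (- ?h k) - g 0) / (- ?h k)) / 2) \<longlonglongrightarrow> (d + d) / 2"
    by (intro tendsto_divide tendsto_add tendsto_const) simp_all
  moreover have "((g (?h k) - g 0) / ?h k + (g (- ?h k) - g 0) / (- ?h k)) / 2 =
      (g (?h k) - g (- ?h k)) / (2 * ?h k)" for k
    by (simp add: field_simps)
  moreover have "(d + d) / 2 = d" by simp
  ultimately show ?thesis by (simp only:)
qed

text \<open>
  The partial derivatives of \<open>f\<close> are pointwise limits of its difference quotients, which stay in the
  finite-dimensional space \<open>polys m\<close>, so they lie in \<open>polys m\<close> themselves. In this way a single
  derivative suffices, and no regularity of the derivatives of \<open>f\<close> has to be assumed.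
\<close>

lemma polys_of_central_differences:
  fixes f :: "real^'n \<Rightarrow> real"
  assumes f: "\<And>x. f differentiable (at x)"
    and diff: "\<And>h i. h > 0 \<Longrightarrow> (\<lambda>x. f (x + h *\<^sub>R axis i 1) - f (x - h *\<^sub>R axis i 1)) \<in> polys m"
  shows "f \<in> polys (Suc m)"
proof (rule polys_of_partials)
  show f': "(f has_derivative frechet_derivative f (at x)) (at x)" for x
    using f frechet_derivative_works by blast
  fix i :: 'n
  let ?h = "\<lambda>k. inverse (real (Suc k))"
  define q where "q k x = inverse (2 * ?h k) *
    (f (x + ?h k *\<^sub>R axis i 1) - f (x - ?h k *\<^sub>R axis i 1))" for k x
  have "q k \<in> polys m" for k
    unfolding q_def[abs_def] by (intro polys_scale diff) simp
  then have "q k \<in> real_fun.span (monomial ` {a. sum a UNIV \<le> m})" for k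
    by (simp only: polys_def)
  moreover have "(\<lambda>k. q k x) \<longlonglongrightarrow> frechet_derivative f (at x) (axis i 1)" for x
  proof -
    interpret L: bounded_linear "frechet_derivative f (at x)"
      by (rule has_derivative_bounded_linear[OF f'])
    have f0: "(f has_derivative frechet_derivative f (at x)) (at (x + 0 *\<^sub>R axis i 1))"
      using f'[of x] by simp
    have "((\<lambda>s. f (x + s *\<^sub>R axis i 1)) has_derivative
        (\<lambda>s. frechet_derivative f (at x) (s *\<^sub>R axis i 1))) (at 0)"
      by (rule has_derivative_compose[of "\<lambda>s. x + s *\<^sub>R axis i 1" "\<lambda>s. s *\<^sub>R axis i 1" 0 UNIV f,
            OF _ f0]) (auto intro!: derivative_eq_intros)
    moreover have "frechet_derivative f (at x) (s *\<^sub>R axis i 1) =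
        frechet_derivative f (at x) (axis i 1) * s" for s by (simp add: L.scaleR)
    ultimately have "((\<lambda>s. f (x + s *\<^sub>R axis i 1)) has_real_derivative
        frechet_derivative f (at x) (axis i 1)) (at 0)"
      by (simp only: has_field_derivative_def)
    from central_difference_quotient_tendsto[OF this]
    have "(\<lambda>k. (f (x + ?h k *\<^sub>R axis i 1) - f (x + (- ?h k) *\<^sub>R axis i 1)) / (2 * ?h k))
        \<longlonglongrightarrow> frechet_derivative f (at x) (axis i 1)" .
    moreover have "(f (x + ?h k *\<^sub>R axis i 1) - f (x + (- ?h k) *\<^sub>R axis i 1)) / (2 * ?h k) = q k x" for k
      unfolding q_def divide_inverse scaleR_minus_left add_uminus_conv_diff by (rule mult.commute)
    ultimately show ?thesis by (simp only:)
  qed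
  ultimately show "(\<lambda>x. frechet_derivative f (at x) (axis i 1)) \<in> polys m"
    unfolding polys_def by (rule span_closed_pointwise[OF finite_imageI[OF finite_multi_indices]])
qed

lemma constant_of_central_differences:
  fixes f :: "real^'n \<Rightarrow> real"
  assumes "\<And>h i x. h > 0 \<Longrightarrow> f (x + h *\<^sub>R axis i 1) = f (x - h *\<^sub>R axis i 1)"
  shows "f x = f 0"
proof -
  have pos: "f (x + s *\<^sub>R axis i 1) = f x" if "s > 0" for s x i
    using assms[of "s / 2" "x + (s / 2) *\<^sub>R axis i 1" i] that
    by (simp add: add.assoc scaleR_add_left[symmetric])
  have axis: "f (x + s *\<^sub>R axis i 1) = f x" for s x i
    using pos[of s x i] pos[of "- s" "x + s *\<^sub>R axis i 1" i] by (cases s "0::real" rule: linorder_cases) auto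
  have "f (\<Sum>i\<in>I. (x $ i) *\<^sub>R axis i 1) = f 0" for I
    using finite[of I]
  proof (induction rule: finite_induct)
    case (insert i I)
    then show ?case using axis[of "\<Sum>i\<in>I. (x $ i) *\<^sub>R axis i 1" "x $ i" i] by (simp add: add.commute)
  qed simp
  from this[of UNIV] show ?thesis using basis_expansion[of x] by (simp add: scalar_mult_eq_scaleR)
qed

section \<open>A maximum principle and the reflection estimate\<close>

definition reflect :: "'n \<Rightarrow> real \<Rightarrow> real^'n \<Rightarrow> real^'n" where
  "reflect i c x = x + (2 * (c - x $ i)) *\<^sub>R axis i 1"

lemma reflect_nth: "reflect i c x $ j = (if j = i then 2 * c - x $ i else x $ j)"
  by (simp add: reflect_def axis_def)

lemma reflect_line:
  "reflect i c (x + s *\<^sub>R axis j 1) = reflect i c x + ((if j = i then -1 else 1) * s) *\<^sub>R axis j 1"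
  by (auto simp: vec_eq_iff reflect_nth axis_def)

lemma axis_derivs_reflect:
  fixes f :: "real^'n \<Rightarrow> real"
  assumes f: "axis_derivs f f1 f2"
  shows "axis_derivs (\<lambda>x. f (reflect i c x))
    (\<lambda>j x. (if j = i then -1 else 1) * f1 j (reflect i c x)) (\<lambda>j x. f2 j (reflect i c x))"
proof -
  have "((\<lambda>s. f (reflect i c (x + s *\<^sub>R axis j 1))) has_real_derivative
      (if j = i then -1 else 1) * f1 j (reflect i c x)) (at 0) \<and>
    ((\<lambda>s. (if j = i then -1 else 1) * f1 j (reflect i c (x + s *\<^sub>R axis j 1))) has_real_derivative
      f2 j (reflect i c x)) (at 0)" for x j
  proof -
    define e :: real where "e = (if j = i then -1 else 1)"
    have e: "e * e = 1" by (simp add: e_def)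
    have lin: "((\<lambda>s. e * s) has_real_derivative e) (at 0)"
      using DERIV_cmult_Id[of e 0] by simp
    have D1: "((\<lambda>s. f (reflect i c x + (e * s) *\<^sub>R axis j 1)) has_real_derivative
        f1 j (reflect i c x + (e * 0) *\<^sub>R axis j 1) * e) (at 0)"
      by (rule DERIV_chain2[where f = "\<lambda>r. f (reflect i c x + r *\<^sub>R axis j 1)"
            and g = "\<lambda>s. e * s", OF axis_derivs_along(1)[OF f] lin])
    have "((\<lambda>s. f1 j (reflect i c x + (e * s) *\<^sub>R axis j 1)) has_real_derivative
        f2 j (reflect i c x + (e * 0) *\<^sub>R axis j 1) * e) (at 0)"
      by (rule DERIV_chain2[where f = "\<lambda>r. f1 j (reflect i c x + r *\<^sub>R axis j 1)"
            and g = "\<lambda>s. e * s", OF axis_derivs_along(2)[OF f] lin])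
    from DERIV_cmult[OF this, of e]
    have D2: "((\<lambda>s. e * f1 j (reflect i c x + (e * s) *\<^sub>R axis j 1)) has_real_derivative
        e * (f2 j (reflect i c x + (e * 0) *\<^sub>R axis j 1) * e)) (at 0)" .
    have e1: "f1 j (reflect i c x + (e * 0) *\<^sub>R axis j 1) * e = e * f1 j (reflect i c x)"
      by simp
    have e2: "e * (f2 j (reflect i c x + (e * 0) *\<^sub>R axis j 1) * e) = f2 j (reflect i c x)"
      using e by (simp add: mult.left_commute)
    show ?thesis
      unfolding reflect_line e_def[symmetric] by (rule conjI[OF D1[unfolded e1] D2[unfolded e2]])
  qed
  then show ?thesis unfolding axis_derivs_def by blast
qed

lemma laplacian_reflect:
  assumes "twice_axis_differentiable f"
  shows "twice_axis_differentiable (\<lambda>x. f (reflect i c x))"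
    and "laplacian (\<lambda>x. f (reflect i c x)) x = laplacian f (reflect i c x)"
proof -
  obtain f1 f2 where f: "axis_derivs f f1 f2"
    using assms unfolding twice_axis_differentiable_def by blast
  note * = axis_derivs_reflect[OF f, of i c]
  show "twice_axis_differentiable (\<lambda>x. f (reflect i c x))"
    unfolding twice_axis_differentiable_def using * by blast
  show "laplacian (\<lambda>x. f (reflect i c x)) x = laplacian f (reflect i c x)"
    using laplacian_eq_sum[OF *] laplacian_eq_sum[OF f] by simp
qed

lemma axis_derivs_separated:
  fixes g :: "'n::finite \<Rightarrow> real \<Rightarrow> real"
  assumes "\<And>i s. (g i has_real_derivative g1 i s) (at s)"
    and "\<And>i s. (g1 i has_real_derivative g2 i s) (at s)"
  shows "axis_derivs (\<lambda>x. \<Sum>j\<in>UNIV. g j (x $ j)) (\<lambda>i x. g1 i (x $ i)) (\<lambda>i x. g2 i (x $ i))"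
proof -
  have "((\<lambda>s. \<Sum>j\<in>UNIV. g j ((x + s *\<^sub>R axis i 1) $ j)) has_real_derivative g1 i (x $ i)) (at 0)"
    for x :: "real^'n" and i
  proof -
    have "(\<Sum>j\<in>UNIV. g j ((x + s *\<^sub>R axis i 1) $ j)) =
        g i (x $ i + s) + (\<Sum>j\<in>UNIV - {i}. g j (x $ j))" for s
    proof -
      have "(\<Sum>j\<in>UNIV - {i}. g j ((x + s *\<^sub>R axis i 1) $ j)) = (\<Sum>j\<in>UNIV - {i}. g j (x $ j))"
        by (rule sum.cong) (auto simp: axis_def)
      then show ?thesis by (subst sum.remove[of _ i]) (auto simp: axis_def)
    qed
    moreover have "((\<lambda>s. g i (x $ i + s) + (\<Sum>j\<in>UNIV - {i}. g j (x $ j))) has_real_derivative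
        g1 i (x $ i) + 0) (at 0)"
      using DERIV_shift[of "g i" "g1 i (x $ i)" 0 "x $ i"] assms(1)[of i "x $ i"]
      by (intro DERIV_add DERIV_const) (simp add: add.commute)
    ultimately show ?thesis by simp
  qed
  moreover have "((\<lambda>s. g1 i ((x + s *\<^sub>R axis i 1) $ i)) has_real_derivative g2 i (x $ i)) (at 0)"
    for x :: "real^'n" and i
    using DERIV_shift[of "g1 i" "g2 i (x $ i)" 0 "x $ i"] assms(2)[of i "x $ i"]
    by (simp add: add.commute axis_def)
  ultimately show ?thesis unfolding axis_derivs_def by blast
qed

lemma second_derivative_nonpos_at_max:
  fixes g :: "real \<Rightarrow> real"
  assumes g: "\<And>s. (g has_real_derivative g1 s) (at s)" "(g1 has_real_derivative g2) (at 0)"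
    and d: "d > 0" "\<And>s. \<bar>s\<bar> < d \<Longrightarrow> g s \<le> g 0"
  shows "g2 \<le> 0"
proof (rule ccontr)
  assume "\<not> g2 \<le> 0"
  have "g1 0 = 0"
    by (rule DERIV_local_max[OF g(1)[of 0] d(1)]) (use d(2) in auto)
  obtain r where r: "r > 0" "\<And>h. 0 < h \<Longrightarrow> h < r \<Longrightarrow> g1 0 < g1 h"
    using has_real_derivative_pos_inc_right[OF g(2)] \<open>\<not> g2 \<le> 0\<close> by auto
  define b where "b = min r d / 2"
  have b: "0 < b" "b < r" "b < d" using r(1) d(1) by (auto simp: b_def min_def)
  have "g 0 < g b"
  proof (rule DERIV_pos_imp_increasing_open[OF b(1)])
    show "\<exists>y. (g has_real_derivative y) (at x) \<and> y > 0" if "0 < x" "x < b" for x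
      using g(1)[of x] r(2)[of x] that b \<open>g1 0 = 0\<close> by (intro exI[of _ "g1 x"]) simp
    show "continuous_on {0..b} g"
      using g(1) by (intro continuous_at_imp_continuous_on ballI) (blast intro: DERIV_isCont)
  qed
  then show False using d(2)[of b] b by simp
qed

lemma laplacian_nonpos_at_max:
  fixes f :: "real^'n \<Rightarrow> real"
  assumes "twice_axis_differentiable f" "open U" "x \<in> U" "\<And>y. y \<in> U \<Longrightarrow> f y \<le> f x"
  shows "laplacian f x \<le> 0"
proof -
  obtain f1 f2 where f: "axis_derivs f f1 f2"
    using assms(1) unfolding twice_axis_differentiable_def by blast
  obtain r where r: "r > 0" "ball x r \<subseteq> U" using assms(2,3) open_contains_ball by blast
  have "f2 i x \<le> 0" for i
  proof (rule second_derivative_nonpos_at_max[where d = r])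
    show "((\<lambda>s. f (x + s *\<^sub>R axis i 1)) has_real_derivative f1 i (x + s *\<^sub>R axis i 1)) (at s)" for s
      by (rule axis_derivs_along(1)[OF f])
    show "((\<lambda>s. f1 i (x + s *\<^sub>R axis i 1)) has_real_derivative f2 i x) (at 0)"
      using f unfolding axis_derivs_def by blast
    show "f (x + s *\<^sub>R axis i 1) \<le> f (x + 0 *\<^sub>R axis i 1)" if "\<bar>s\<bar> < r" for s
    proof -
      have "x + s *\<^sub>R axis i 1 \<in> ball x r" using that by (simp add: dist_norm)
      then show ?thesis using assms(4) r(2) by auto
    qed
  qed (rule r(1))
  then show ?thesis unfolding laplacian_eq_sum[OF f] by (intro sum_nonpos) simp
qed

text \<open>
  At a positive maximum away from the parabolic boundary the Laplacian would be nonpositive and the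
  one-sided time derivative nonnegative, against the strict inequality. Derivatives in time are taken
  from the past, so the maximum may be attained at the final time \<open>tb\<close>.
\<close>

lemma parabolic_maximum_principle:
  fixes w :: "(real^'n) \<times> real \<Rightarrow> real"
  assumes cont: "continuous_on (cbox a b \<times> {ta..tb}) w"
    and space: "\<And>t. ta < t \<Longrightarrow> t \<le> tb \<Longrightarrow> twice_axis_differentiable (\<lambda>y. w (y, t))"
    and time: "\<And>y t. ta < t \<Longrightarrow> t \<le> tb \<Longrightarrow>
      ((\<lambda>s. w (y, s)) has_real_derivative wt y t) (at t within {..t})"
    and strict: "\<And>y t. y \<in> box a b \<Longrightarrow> ta < t \<Longrightarrow> t \<le> tb \<Longrightarrow>
      wt y t < laplacian (\<lambda>y. w (y, t)) y"
    and bdry: "\<And>y t. y \<in> cbox a b \<Longrightarrow> ta \<le> t \<Longrightarrow> t \<le> tb \<Longrightarrow>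
      y \<notin> box a b \<or> t = ta \<Longrightarrow> w (y, t) \<le> 0"
    and y: "y \<in> cbox a b" "ta \<le> t" "t \<le> tb"
  shows "w (y, t) \<le> 0"
proof -
  have "compact (cbox a b \<times> {ta..tb})" by (intro compact_Times compact_cbox compact_Icc)
  moreover have "cbox a b \<times> {ta..tb} \<noteq> {}" using y by auto
  ultimately obtain z where z: "z \<in> cbox a b \<times> {ta..tb}"
    "\<And>z'. z' \<in> cbox a b \<times> {ta..tb} \<Longrightarrow> w z' \<le> w z"
    using continuous_attains_sup[OF _ _ cont] by blast
  obtain x s where xs: "z = (x, s)" by fastforce
  have x: "x \<in> cbox a b" "ta \<le> s" "s \<le> tb" using z(1) xs by auto
  have "w (x, s) \<le> 0"
  proof (rule ccontr)
    assume "\<not> w (x, s) \<le> 0"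
    then have "x \<in> box a b" "s \<noteq> ta" using bdry[OF x] by auto
    then have int: "x \<in> box a b" "ta < s" using x(2) by auto
    have "laplacian (\<lambda>y. w (y, s)) x \<le> 0"
    proof (rule laplacian_nonpos_at_max[OF space[OF int(2) x(3)] open_box int(1)])
      fix y assume "y \<in> box a b"
      then show "w (y, s) \<le> w (x, s)"
        using z(2)[of "(y, s)"] x xs box_subset_cbox[of a b] by auto
    qed
    moreover have "wt x s \<ge> 0"
    proof (rule ccontr)
      assume "\<not> wt x s \<ge> 0"
      then obtain d where d: "d > 0" "\<And>h. 0 < h \<Longrightarrow> s - h \<in> {..s} \<Longrightarrow> h < d \<Longrightarrow> w (x, s) < w (x, s - h)"
        using has_real_derivative_neg_dec_left[OF time[OF int(2) x(3), of x]] by auto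
      define h where "h = min d (s - ta) / 2"
      have h: "0 < h" "h < d" "h \<le> s - ta" using d(1) int(2) by (auto simp: h_def min_def)
      then have "w (x, s) < w (x, s - h)" using d(2)[of h] by auto
      moreover have "w (x, s - h) \<le> w (x, s)" using z(2)[of "(x, s - h)"] x xs h by auto
      ultimately show False by simp
    qed
    ultimately show False using strict[OF int x(3)] by simp
  qed
  then show ?thesis using z(2)[of "(y, t)"] y xs by auto
qed

text \<open>
  A weak notion of ancient solution, covering both ancient solutions and harmonic functions viewed
  as constant in time. It asks only for what the maximum principle and the passage from differences
  to derivatives use, and is therefore visibly stable under central differences in space.
\<close>

definition caloric :: "((real^'n) \<times> real \<Rightarrow> real) \<Rightarrow> bool" where
  "caloric u \<longleftrightarrow> continuous_on (UNIV \<times> {..0}) u \<and>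
    (\<forall>t\<le>0. twice_axis_differentiable (\<lambda>y. u (y, t)) \<and>
      (\<forall>x. (\<lambda>y. u (y, t)) differentiable (at x)) \<and>
      (\<forall>x. ((\<lambda>s. u (x, s)) has_real_derivative laplacian (\<lambda>y. u (y, t)) x) (at t within {..0})))"

text \<open>
  The difference \<open>u - u \<circ> \<rho>\<close> of \<open>u\<close> and its reflection in the hyperplane through \<open>p\<close> orthogonal to
  the \<open>i\<close>-th axis is caloric, vanishes on that hyperplane and is at most \<open>2 M\<close>. On the half cube to one
  side of it, and with \<open>p = 0\<close>, it is compared with \<open>2 M / R\<^sup>2\<close> times the barrier
  \<open>(\<Sum>j\<noteq>i. y\<^sub>j\<^sup>2) + (t0 - t) + n (2 R y\<^sub>i - y\<^sub>i\<^sup>2)\<close>. The barrier is a strict supersolution: its time derivative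
  is \<open>- 1\<close> and its Laplacian \<open>2 (n - 1) - 2 n = - 2\<close>. It is nonnegative, and at least \<open>R\<^sup>2\<close> on the part of the
  parabolic boundary off the hyperplane. At \<open>y = h e\<^sub>i\<close>, \<open>t = t0\<close> it is at most \<open>2 n R h\<close>.
\<close>

lemma reflection_estimate_upper:
  fixes u :: "(real^'n) \<times> real \<Rightarrow> real" and h R M :: real
  assumes u: "caloric u" and t0: "t0 \<le> 0" and h: "0 \<le> h" "h \<le> R" and R: "R > 0" and M: "M > 0"
    and bound: "\<And>y t. (\<And>j. \<bar>y $ j - p $ j\<bar> \<le> R) \<Longrightarrow> t0 - R\<^sup>2 \<le> t \<Longrightarrow> t \<le> t0 \<Longrightarrow> \<bar>u (y, t)\<bar> \<le> M"
  shows "u (p + h *\<^sub>R axis i 1, t0) - u (p - h *\<^sub>R axis i 1, t0) \<le> 4 * real CARD('n) * M * h / R"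
proof -
  define n where "n = real CARD('n)"
  have n: "n \<ge> 1" by (simp add: n_def Suc_leI)
  \<comment> \<open>Scaled by \<open>c\<close>, a barrier value of \<open>R\<^sup>2\<close> becomes the bound \<open>2 * M\<close>.\<close>
  define c where "c = 2 * M / R\<^sup>2"
  have c: "c > 0" "c * R\<^sup>2 = 2 * M" using M R by (simp_all add: c_def)
  \<comment> \<open>The spatial part of the barrier, split into functions of one coordinate each.\<close>
  define g where "g j s = (if j = i then n * (2 * R * (s - p $ i) - (s - p $ i)\<^sup>2) else (s - p $ j)\<^sup>2)"
    for j s
  define g1 where "g1 j s = (if j = i then n * (2 * R - 2 * (s - p $ i)) else 2 * (s - p $ j))" for j s
  define g2 where "g2 j s = (if j = i then - 2 * n else 2)" for j and s :: real
  define f where "f y = (\<Sum>j\<in>UNIV. g j (y $ j))" for y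
  have f: "axis_derivs f (\<lambda>j y. g1 j (y $ j)) (\<lambda>j y. g2 j (y $ j))"
    unfolding f_def
  proof (rule axis_derivs_separated)
    show "(g j has_real_derivative g1 j s) (at s)" for j s
      unfolding g_def g1_def by (cases "j = i") (auto intro!: derivative_eq_intros)
    show "(g1 j has_real_derivative g2 j s) (at s)" for j s
      unfolding g1_def g2_def by (cases "j = i") (auto intro!: derivative_eq_intros)
  qed
  have f_twice: "twice_axis_differentiable f"
    using f unfolding twice_axis_differentiable_def by blast
  have lap_f: "laplacian f y = - 2" for y
  proof -
    have "laplacian f y = g2 i (y $ i) + (\<Sum>j\<in>UNIV - {i}. g2 j (y $ j))"
      unfolding laplacian_eq_sum[OF f] by (subst sum.remove[of _ i]) auto
    also have "(\<Sum>j\<in>UNIV - {i}. g2 j (y $ j)) = (\<Sum>j\<in>UNIV - {i}. 2)"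
      by (rule sum.cong) (auto simp: g2_def)
    also have "\<dots> = 2 * (n - 1)" by (simp add: n_def card_Diff_subset of_nat_diff Suc_leI)
    finally show ?thesis by (simp add: g2_def)
  qed
  define \<rho> where "\<rho> = reflect i (p $ i)"
  define w where "w z = u z - u (\<rho> (fst z), snd z) - c * (f (fst z) + (t0 - snd z))" for z
  define a where "a = (\<chi> j. if j = i then p $ i else p $ j - R)"
  define b where "b = (\<chi> j. p $ j + R)"
  have cube: "\<bar>y $ j - p $ j\<bar> \<le> R" "\<bar>\<rho> y $ j - p $ j\<bar> \<le> R" if "y \<in> cbox a b" for y j
    using that[unfolded mem_box_cart, rule_format, of j]
    by (auto simp: \<rho>_def reflect_nth a_def b_def split: if_splits)
  have g_nonneg: "g j (y $ j) \<ge> 0" if "y \<in> cbox a b" for y j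
  proof (cases "j = i")
    case True
    have "0 \<le> y $ i - p $ i" "y $ i - p $ i \<le> R"
      using that[unfolded mem_box_cart, rule_format, of i] by (auto simp: a_def b_def)
    then have "0 \<le> (y $ i - p $ i) * (2 * R - (y $ i - p $ i))" by (intro mult_nonneg_nonneg) auto
    then have "0 \<le> n * ((y $ i - p $ i) * (2 * R - (y $ i - p $ i)))"
      by (rule mult_nonneg_nonneg[OF order_trans[OF zero_le_one n]])
    then show ?thesis using True by (simp add: g_def algebra_simps power2_eq_square)
  qed (simp add: g_def)
  have "w (p + h *\<^sub>R axis i 1, t0) \<le> 0"
  proof (rule parabolic_maximum_principle[where ta = "t0 - R\<^sup>2" and tb = t0 and a = a and b = b
        and wt = "\<lambda>y t. laplacian (\<lambda>y. u (y, t)) y - laplacian (\<lambda>y. u (y, t)) (\<rho> y) - c * (0 + (0 - 1))"])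
    have cu: "continuous_on (UNIV \<times> {..0}) u" using u by (simp add: caloric_def)
    have crho: "continuous_on S \<rho>" for S
      unfolding \<rho>_def reflect_def by (intro continuous_intros)
    have "continuous_on S (\<lambda>y. g j (y $ j))" for S j
      unfolding g_def by (cases "j = i") (auto intro!: continuous_intros)
    then have cf: "continuous_on S f" for S
      unfolding f_def by (intro continuous_on_sum)
    have sub: "cbox a b \<times> {t0 - R\<^sup>2..t0} \<subseteq> UNIV \<times> {..0}" using t0 by auto
    have "continuous_on (cbox a b \<times> {t0 - R\<^sup>2..t0}) (\<lambda>z. u (\<rho> (fst z), snd z))"
      by (rule continuous_on_compose2[OF cu])
        (use t0 in \<open>auto intro!: continuous_intros continuous_on_compose2[OF crho]\<close>)
    then show "continuous_on (cbox a b \<times> {t0 - R\<^sup>2..t0}) w"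
      unfolding w_def
      by (intro continuous_intros continuous_on_subset[OF cu sub] continuous_on_compose2[OF cf]) auto
    have wt: "twice_axis_differentiable (\<lambda>y. w (y, t)) \<and>
        laplacian (\<lambda>y. w (y, t)) y =
          laplacian (\<lambda>y. u (y, t)) y - laplacian (\<lambda>y. u (y, t)) (\<rho> y) + 2 * c"
      if "t \<le> t0" for t y
    proof -
      have ut: "twice_axis_differentiable (\<lambda>y. u (y, t))" using u that t0 by (simp add: caloric_def)
      note ur = laplacian_reflect[OF ut, of i "p $ i", folded \<rho>_def]
      have const: "axis_derivs (\<lambda>y::real^'n. t0 - t) (\<lambda>_ _. 0) (\<lambda>_ _. 0)"
        by (simp add: axis_derivs_def)
      have const2: "twice_axis_differentiable (\<lambda>y::real^'n. t0 - t)"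
        unfolding twice_axis_differentiable_def using const by blast
      have const_lap: "laplacian (\<lambda>y::real^'n. t0 - t) y = 0" for y
        using laplacian_eq_sum[OF const] by simp
      note 1 = laplacian_lincomb[OF ut ur(1), of 1 "-1"]
      note 2 = laplacian_lincomb[OF f_twice const2, of 1 1]
      note 3 = laplacian_lincomb[OF 1(1) 2(1), of 1 "- c"]
      have eq: "(\<lambda>y. w (y, t)) = (\<lambda>y. 1 * (1 * u (y, t) + - 1 * u (\<rho> y, t)) + - c * (1 * f y + 1 * (t0 - t)))"
        by (simp add: w_def fun_eq_iff)
      show ?thesis
        unfolding eq using 3 unfolding 1(2) 2(2) ur(2) lap_f const_lap by simp
    qed
    show "twice_axis_differentiable (\<lambda>y. w (y, t))" if "t0 - R\<^sup>2 < t" "t \<le> t0" for t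
      using wt[OF that(2)] by blast
    show "((\<lambda>s. w (y, s)) has_real_derivative laplacian (\<lambda>y. u (y, t)) y -
        laplacian (\<lambda>y. u (y, t)) (\<rho> y) - c * (0 + (0 - 1))) (at t within {..t})"
      if "t0 - R\<^sup>2 < t" "t \<le> t0" for y t
    proof -
      have D: "((\<lambda>s. u (y, s)) has_real_derivative laplacian (\<lambda>y. u (y, t)) y) (at t within {..t})" for y
        using u that(2) t0 by (intro DERIV_subset[where s = "{..0}" and t = "{..t}"]) (auto simp: caloric_def)
      show ?thesis unfolding w_def fst_conv snd_conv
        by (intro DERIV_diff DERIV_add DERIV_cmult DERIV_const DERIV_ident D)
    qed
    show "laplacian (\<lambda>y. u (y, t)) y - laplacian (\<lambda>y. u (y, t)) (\<rho> y) - c * (0 + (0 - 1)) <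
        laplacian (\<lambda>y. w (y, t)) y" if "t \<le> t0" for y t
      using wt[OF that, of y] c(1) by simp
    \<comment> \<open>On the hyperplane \<open>w\<close> is minus the scaled barrier; elsewhere on the parabolic boundary that
      barrier dominates.\<close>
    show "w (y, t) \<le> 0" if y: "y \<in> cbox a b" and t: "t0 - R\<^sup>2 \<le> t" "t \<le> t0"
      and bd: "y \<notin> box a b \<or> t = t0 - R\<^sup>2" for y t
    proof -
      have f0: "f y \<ge> 0" unfolding f_def by (intro sum_nonneg g_nonneg[OF y])
      have u2: "u (y, t) - u (\<rho> y, t) \<le> 2 * M"
        using bound[OF cube(1)[OF y] t] bound[OF cube(2)[OF y] t] by linarith
      show ?thesis
      proof (cases "\<rho> y = y")
        case True
        then show ?thesis using f0 c(1) t(2) by (simp add: w_def)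
      next
        case False
        have "f y + (t0 - t) \<ge> R\<^sup>2"
        proof (cases "t = t0 - R\<^sup>2")
          case True
          then show ?thesis using f0 by simp
        next
          case False2: False
          then obtain j where j: "\<not> (a $ j < y $ j \<and> y $ j < b $ j)" using bd by (auto simp: mem_box_cart)
          have ab: "a $ j \<le> y $ j" "y $ j \<le> b $ j" using y by (auto simp: mem_box_cart)
          have "g j (y $ j) \<ge> R\<^sup>2"
          proof (cases "j = i")
            case True
            have "y $ i \<noteq> p $ i"
            proof
              assume "y $ i = p $ i"
              then have "\<rho> y = y" by (auto simp: vec_eq_iff \<rho>_def reflect_nth)
              with False show False by simp
            qed
            then have "y $ i - p $ i = R" using j ab True by (simp add: a_def b_def)
            then have "g j (y $ j) = n * R\<^sup>2" using True by (simp add: g_def power2_eq_square)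
            then show ?thesis using n mult_right_mono[of 1 n "R\<^sup>2"] by simp
          next
            case False
            then have "y $ j - p $ j = R \<or> y $ j - p $ j = - R"
              using j ab by (auto simp: a_def b_def)
            then show ?thesis using False by (auto simp: g_def)
          qed
          also have "g j (y $ j) \<le> f y"
            unfolding f_def by (rule member_le_sum) (auto intro: g_nonneg[OF y])
          finally show ?thesis using t(2) by simp
        qed
        then have "c * R\<^sup>2 \<le> c * (f y + (t0 - t))" using c(1) by (intro mult_left_mono) auto
        then show ?thesis using u2 c(2) by (simp add: w_def)
      qed
    qed
    show "p + h *\<^sub>R axis i 1 \<in> cbox a b"
      using h R by (auto simp: mem_box_cart a_def b_def axis_def)
    show "t0 - R\<^sup>2 \<le> t0" by simp
  qed simp
  moreover have "\<rho> (p + h *\<^sub>R axis i 1) = p - h *\<^sub>R axis i 1"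
    by (auto simp: vec_eq_iff \<rho>_def reflect_nth axis_def)
  moreover have "f (p + h *\<^sub>R axis i 1) = n * (2 * R * h - h\<^sup>2)"
  proof -
    have "(\<Sum>j\<in>UNIV - {i}. g j ((p + h *\<^sub>R axis i 1) $ j)) = 0"
      by (rule sum.neutral) (auto simp: g_def axis_def)
    then show ?thesis unfolding f_def by (subst sum.remove[of _ i]) (auto simp: g_def axis_def)
  qed
  ultimately have "u (p + h *\<^sub>R axis i 1, t0) - u (p - h *\<^sub>R axis i 1, t0) \<le> c * (n * (2 * R * h - h\<^sup>2))"
    by (simp add: w_def)
  also have "\<dots> \<le> c * (n * (2 * R * h))"
    using c(1) n by (intro mult_left_mono) auto
  also have "\<dots> = 4 * n * M * h / R"
    using R by (simp add: c_def power2_eq_square field_simps)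
  finally show ?thesis by (simp add: n_def)
qed

section \<open>Central differences lower the growth order\<close>

lemma caloric_lincomb:
  fixes u v :: "(real^'n) \<times> real \<Rightarrow> real"
  assumes u: "caloric u" and v: "caloric v"
  shows "caloric (\<lambda>z. a * u z + b * v z)"
  unfolding caloric_def
proof (intro conjI allI impI)
  show "continuous_on (UNIV \<times> {..0}) (\<lambda>z. a * u z + b * v z)"
    using u v by (auto simp: caloric_def intro!: continuous_intros)
  fix t :: real assume t: "t \<le> 0"
  have tw: "twice_axis_differentiable (\<lambda>y. u (y, t))" "twice_axis_differentiable (\<lambda>y. v (y, t))"
    using u v t by (auto simp: caloric_def)
  show "twice_axis_differentiable (\<lambda>y. a * u (y, t) + b * v (y, t))"
    by (rule laplacian_lincomb(1)[OF tw])
  fix x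
  show "(\<lambda>y. a * u (y, t) + b * v (y, t)) differentiable at x"
    using u v t by (auto simp: caloric_def intro!: derivative_intros)
  show "((\<lambda>s. a * u (x, s) + b * v (x, s)) has_real_derivative
      laplacian (\<lambda>y. a * u (y, t) + b * v (y, t)) x) (at t within {..0})"
    unfolding laplacian_lincomb(2)[OF tw]
    using u v t by (intro DERIV_add DERIV_cmult) (auto simp: caloric_def)
qed

lemma caloric_translate:
  fixes u :: "(real^'n) \<times> real \<Rightarrow> real"
  assumes u: "caloric u"
  shows "caloric (\<lambda>z. u (fst z + a, snd z))"
  unfolding caloric_def fst_conv snd_conv
proof (intro conjI allI impI)
  have cu: "continuous_on (UNIV \<times> {..0}) u" using u by (simp add: caloric_def)
  show "continuous_on (UNIV \<times> {..0}) (\<lambda>z. u (fst z + a, snd z))"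
    by (rule continuous_on_compose2[OF cu]) (auto intro!: continuous_intros)
  fix t :: real assume t: "t \<le> 0"
  have tw: "twice_axis_differentiable (\<lambda>y. u (y, t))" using u t by (auto simp: caloric_def)
  show "twice_axis_differentiable (\<lambda>y. u (y + a, t))"
    by (rule laplacian_translate(1)[OF tw])
  fix x
  show "(\<lambda>y. u (y + a, t)) differentiable at x"
    by (rule differentiable_compose[of "\<lambda>y. u (y, t)" "\<lambda>y. y + a"])
      (use u t in \<open>auto simp: caloric_def intro!: derivative_intros\<close>)
  show "((\<lambda>s. u (x + a, s)) has_real_derivative laplacian (\<lambda>y. u (y + a, t)) x) (at t within {..0})"
    unfolding laplacian_translate(2)[OF tw] using u t by (auto simp: caloric_def)
qed

definition central_difference ::
    "real \<Rightarrow> 'n \<Rightarrow> ((real^'n) \<times> real \<Rightarrow> real) \<Rightarrow> (real^'n) \<times> real \<Rightarrow> real" where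
  "central_difference h i u z =
    u (fst z + h *\<^sub>R axis i 1, snd z) - u (fst z - h *\<^sub>R axis i 1, snd z)"

lemma caloric_central_difference:
  fixes u :: "(real^'n) \<times> real \<Rightarrow> real"
  assumes "caloric u"
  shows "caloric (central_difference h i u)"
proof -
  have eq: "central_difference h i u = (\<lambda>z. 1 * u (fst z + h *\<^sub>R axis i 1, snd z) +
      (-1) * u (fst z + - h *\<^sub>R axis i 1, snd z))"
    by (simp add: central_difference_def fun_eq_iff)
  show ?thesis
    unfolding eq by (rule caloric_lincomb[OF caloric_translate[OF assms] caloric_translate[OF assms]])
qed

lemma reflection_estimate:
  fixes u :: "(real^'n) \<times> real \<Rightarrow> real" and h R M :: real
  assumes u: "caloric u" and t0: "t0 \<le> 0" and h: "0 \<le> h" "h \<le> R" and R: "R > 0" and M: "M > 0"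
    and bound: "\<And>y t. (\<And>j. \<bar>y $ j - p $ j\<bar> \<le> R) \<Longrightarrow> t0 - R\<^sup>2 \<le> t \<Longrightarrow> t \<le> t0 \<Longrightarrow> \<bar>u (y, t)\<bar> \<le> M"
  shows "\<bar>central_difference h i u (p, t0)\<bar> \<le> 4 * real CARD('n) * M * h / R"
proof -
  have neg: "caloric (\<lambda>z. - u z)" using caloric_lincomb[OF u u, of "-1" 0] by simp
  have "u (p + h *\<^sub>R axis i 1, t0) - u (p - h *\<^sub>R axis i 1, t0) \<le> 4 * real CARD('n) * M * h / R"
    by (rule reflection_estimate_upper[OF u t0 h R M bound])
  moreover have "- u (p + h *\<^sub>R axis i 1, t0) - - u (p - h *\<^sub>R axis i 1, t0) \<le>
      4 * real CARD('n) * M * h / R"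
    by (rule reflection_estimate_upper[OF neg t0 h R M]) (simp add: bound)
  ultimately show ?thesis by (simp add: central_difference_def abs_le_iff)
qed

text \<open>
  The growth condition of the theorem in pointwise form, with \<open>1 + \<bar>x\<bar> + sqrt (- t)\<close> measuring the parabolic
  distance to the origin.
\<close>

definition parabolic_growth :: "nat \<Rightarrow> ((real^'n) \<times> real \<Rightarrow> real) \<Rightarrow> bool" where
  "parabolic_growth m u \<longleftrightarrow>
    (\<exists>C>0. \<forall>x. \<forall>t\<le>0. \<bar>u (x, t)\<bar> \<le> C * (1 + norm x + sqrt (- t)) ^ m)"

lemma parabolic_size_in_cube:
  fixes x y :: "real^'n"
  assumes "\<And>j. \<bar>y $ j - x $ j\<bar> \<le> R" "t0 - R\<^sup>2 \<le> t" "t0 \<le> 0" "1 + norm x + sqrt (- t0) \<le> R"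
  shows "1 + norm y + sqrt (- t) \<le> (real CARD('n) + 2) * R"
proof -
  have R: "R \<ge> 0" using assms(4) assms(3) by (smt (verit) norm_ge_zero real_sqrt_ge_zero)
  have "norm (y - x) \<le> (\<Sum>j\<in>UNIV. \<bar>(y - x) $ j\<bar>)" by (rule norm_le_l1_cart)
  also have "\<dots> \<le> (\<Sum>j\<in>(UNIV::'n set). R)" using assms(1) by (intro sum_mono) simp
  finally have "norm (y - x) \<le> real CARD('n) * R" by simp
  moreover have "norm y \<le> norm x + norm (y - x)" by (rule norm_triangle_sub)
  moreover have "sqrt (- t) \<le> sqrt (- t0) + R"
  proof (rule real_le_lsqrt)
    have "- t \<le> (sqrt (- t0))\<^sup>2 + R\<^sup>2" using assms(2,3) by simp
    also have "\<dots> \<le> (sqrt (- t0) + R)\<^sup>2"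
      using R assms(3) by (simp add: power2_sum)
    finally show "- t \<le> (sqrt (- t0) + R)\<^sup>2" .
  qed (use R assms(3) in simp)
  ultimately have "1 + norm y + sqrt (- t) \<le> real CARD('n) * R + 2 * R" using assms(4) by linarith
  then show ?thesis by (simp add: distrib_right)
qed

text \<open>
  The reflection estimate on the parabolic cube of size \<open>R\<close> about \<open>(x, t)\<close>. The gain of the factor \<open>h / R\<close>
  over the size of \<open>u\<close> is what drives both inductions below.
\<close>

lemma central_difference_bound:
  fixes u :: "(real^'n) \<times> real \<Rightarrow> real"
  assumes u: "caloric u" and C: "C > 0" "\<And>x t. t \<le> 0 \<Longrightarrow> \<bar>u (x, t)\<bar> \<le> C * (1 + norm x + sqrt (- t)) ^ m"
    and t: "t \<le> 0" and h: "0 \<le> h" and R: "h \<le> R" "1 + norm x + sqrt (- t) \<le> R"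
  shows "\<bar>central_difference h i u (x, t)\<bar> \<le>
    4 * real CARD('n) * (C * ((real CARD('n) + 2) * R) ^ m) * h / R"
proof (rule reflection_estimate[OF u t h R(1)])
  have "1 \<le> 1 + norm x + sqrt (- t)" using t by simp
  then show Rp: "R > 0" using R(2) by linarith
  show "C * ((real CARD('n) + 2) * R) ^ m > 0" using C(1) Rp by simp
  fix y s assume y: "\<And>j. \<bar>y $ j - x $ j\<bar> \<le> R" and s: "t - R\<^sup>2 \<le> s" "s \<le> t"
  have "1 + norm y + sqrt (- s) \<le> (real CARD('n) + 2) * R"
    by (rule parabolic_size_in_cube[OF y s(1) t R(2)])
  then have "(1 + norm y + sqrt (- s)) ^ m \<le> ((real CARD('n) + 2) * R) ^ m"
    using s(2) t by (intro power_mono) auto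
  then have "C * (1 + norm y + sqrt (- s)) ^ m \<le> C * ((real CARD('n) + 2) * R) ^ m"
    using C(1) by simp
  then show "\<bar>u (y, s)\<bar> \<le> C * ((real CARD('n) + 2) * R) ^ m"
    using C(2)[of s y] s(2) t by linarith
qed

lemma parabolic_growth_central_difference:
  fixes u :: "(real^'n) \<times> real \<Rightarrow> real"
  assumes u: "caloric u" and g: "parabolic_growth (Suc m) u" and h: "h > 0"
  shows "parabolic_growth m (central_difference h i u)"
proof -
  obtain C where C: "C > 0" "\<And>x t. t \<le> 0 \<Longrightarrow> \<bar>u (x, t)\<bar> \<le> C * (1 + norm x + sqrt (- t)) ^ Suc m"
    using g unfolding parabolic_growth_def by blast
  define n where "n = real CARD('n)"
  have n: "n > 0" by (simp add: n_def)
  define K where "K = 4 * n * C * (n + 2) ^ Suc m * h"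
  have K: "K > 0" using n C(1) h by (simp add: K_def)
  have "\<bar>central_difference h i u (x, t)\<bar> \<le> K * (1 + h) ^ m * (1 + norm x + sqrt (- t)) ^ m"
    if t: "t \<le> 0" for x t
  proof -
    define N where "N = 1 + norm x + sqrt (- t)"
    have N: "N \<ge> 1" using t by (simp add: N_def)
    have "\<bar>central_difference h i u (x, t)\<bar> \<le>
        4 * real CARD('n) * (C * ((real CARD('n) + 2) * (h + N)) ^ Suc m) * h / (h + N)"
      by (rule central_difference_bound[OF u C t]) (use h N in \<open>auto simp: N_def\<close>)
    also have "\<dots> = K * (h + N) ^ m"
    proof -
      have "4 * n * (C * (P * (S * Q))) * h / S = 4 * n * C * P * h * Q" if "S \<noteq> 0" for P Q S :: real
        using that by (simp add: field_simps)
      from this[of "h + N" "(n + 2) ^ Suc m" "(h + N) ^ m"] show ?thesis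
        using h N by (simp only: K_def n_def[symmetric] power_mult_distrib power_Suc) simp
    qed
    also have "\<dots> \<le> K * ((1 + h) * N) ^ m"
      using K h N mult_left_mono[of 1 N h] by (intro mult_left_mono power_mono) (auto simp: algebra_simps)
    finally show ?thesis by (simp add: power_mult_distrib N_def mult.assoc)
  qed
  then show ?thesis
    unfolding parabolic_growth_def using K h by (intro exI[of _ "K * (1 + h) ^ m"]) simp
qed

lemma central_difference_eq_0_of_bounded:
  fixes u :: "(real^'n) \<times> real \<Rightarrow> real"
  assumes u: "caloric u" and g: "parabolic_growth 0 u" and h: "h > 0" and t: "t \<le> 0"
  shows "central_difference h i u (x, t) = 0"
proof (rule ccontr)
  define d where "d = \<bar>central_difference h i u (x, t)\<bar>"
  assume "central_difference h i u (x, t) \<noteq> 0"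
  then have d: "d > 0" by (simp add: d_def)
  obtain C where C: "C > 0" "\<And>x t. t \<le> 0 \<Longrightarrow> \<bar>u (x, t)\<bar> \<le> C * (1 + norm x + sqrt (- t)) ^ 0"
    using g unfolding parabolic_growth_def by blast
  define K where "K = 4 * real CARD('n) * C * h"
  have K: "K > 0" using C(1) h by (simp add: K_def)
  \<comment> \<open>The bound \<open>K / R\<close> on the difference, with \<open>R \<ge> 2 * K / d\<close>, contradicts that the difference is \<open>d\<close>.\<close>
  define R where "R = h + (1 + norm x + sqrt (- t)) + 2 * K / d"
  have "0 \<le> norm x" "0 \<le> sqrt (- t)" "0 \<le> 2 * K / d" using t K d by simp_all
  then have R: "h \<le> R" "1 + norm x + sqrt (- t) \<le> R" "2 * K / d \<le> R" "R > 0"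
    using h unfolding R_def by linarith+
  have "d \<le> 4 * real CARD('n) * (C * ((real CARD('n) + 2) * R) ^ 0) * h / R"
    unfolding d_def by (rule central_difference_bound[OF u C t _ R(1,2)]) (use h in auto)
  then have "d * R \<le> K" using R(4) by (simp add: K_def field_simps)
  moreover have "2 * K \<le> R * d" using R(3) d by (simp add: pos_divide_le_eq)
  ultimately show False using K by (simp add: mult.commute)
qed

text \<open>
  Induction on the growth order: central differences of \<open>u\<close> have order lower by one, so their slices are
  polynomials of degree less by one, and hence those of \<open>u\<close> are polynomials. In order zero
  all central differences vanish.
\<close>

lemma caloric_slice_in_polys:
  fixes u :: "(real^'n) \<times> real \<Rightarrow> real"
  assumes "caloric u" "parabolic_growth m u" "t \<le> 0"
  shows "(\<lambda>x. u (x, t)) \<in> polys m"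
  using assms
proof (induction m arbitrary: u)
  case 0
  have "u (x, t) = u (0, t)" for x
  proof (rule constant_of_central_differences[of "\<lambda>x. u (x, t)"])
    show "u (x + h *\<^sub>R axis i 1, t) = u (x - h *\<^sub>R axis i 1, t)" if "h > 0" for h i x
      using central_difference_eq_0_of_bounded[OF 0(1,2) that 0(3), of i x]
      by (simp add: central_difference_def)
  qed
  then have "(\<lambda>x. u (x, t)) = (\<lambda>x. u (0, t))" by (rule ext)
  also have "\<dots> \<in> polys 0" by (rule const_in_polys)
  finally show ?case .
next
  case (Suc m)
  show ?case
  proof (rule polys_of_central_differences)
    show "(\<lambda>x. u (x, t)) differentiable at x" for x
      using Suc.prems by (simp add: caloric_def)
    show "(\<lambda>x. u (x + h *\<^sub>R axis i 1, t) - u (x - h *\<^sub>R axis i 1, t)) \<in> polys m" if "h > 0" for h i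
      using Suc.IH[OF caloric_central_difference[OF Suc.prems(1)]
          parabolic_growth_central_difference[OF Suc.prems(1,2) that] Suc.prems(3), of i]
      by (simp add: central_difference_def)
  qed
qed

lemma caloric_time_independent:
  fixes u :: "(real^'n) \<times> real \<Rightarrow> real"
  assumes u: "caloric u" and t: "t \<le> 0"
    and flat: "\<And>h i x s. h > 0 \<Longrightarrow> s \<le> 0 \<Longrightarrow> central_difference h i u (x, s) = 0"
  shows "u (x, t) = u (x, 0)"
proof -
  have D: "((\<lambda>s. u (x, s)) has_real_derivative 0) (at s within {..0})" if s: "s \<in> {..0}" for s
  proof -
    have s: "s \<le> 0" using s by simp
    have "u (y, s) = u (0, s)" for y
    proof (rule constant_of_central_differences[of "\<lambda>x. u (x, s)"])
      show "u (x + h *\<^sub>R axis i 1, s) = u (x - h *\<^sub>R axis i 1, s)" if "h > 0" for h i x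
        using flat[OF that s, of i x] by (simp add: central_difference_def)
    qed
    then have eq: "(\<lambda>y. u (y, s)) = (\<lambda>y. u (0, s))" by (rule ext)
    have "laplacian (\<lambda>y. u (y, s)) x = 0"
      unfolding eq by (simp only: laplacian_polys_0[OF const_in_polys])
    moreover have "((\<lambda>r. u (x, r)) has_real_derivative laplacian (\<lambda>y. u (y, s)) x)
        (at s within {..0})"
      using u s by (simp add: caloric_def)
    ultimately show ?thesis by (simp only:)
  qed
  from has_field_derivative_zero_constant[OF convex_real_interval(2) D]
  obtain c where c: "\<forall>s\<in>{..0}. u (x, s) = c" ..
  then show ?thesis using t by simp
qed

text \<open>
  The same induction: central differences inherit zero final values, hence vanish, so that \<open>u\<close> does not
  depend on \<open>x\<close>; by the heat equation it does not depend on \<open>t\<close> either. This is uniqueness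
  backwards in time, which holds only because of the growth condition.
\<close>

lemma caloric_unique:
  fixes u :: "(real^'n) \<times> real \<Rightarrow> real"
  assumes "caloric u" "parabolic_growth m u" "\<And>x. u (x, 0) = 0" "t \<le> 0"
  shows "u (x, t) = 0"
  using assms
proof (induction m arbitrary: u x t)
  case 0
  have "u (x, t) = u (x, 0)"
    by (rule caloric_time_independent[OF 0(1,4)])
      (rule central_difference_eq_0_of_bounded[OF 0(1,2)])
  then show ?case using 0(3) by simp
next
  case (Suc m)
  have "u (x, t) = u (x, 0)"
  proof (rule caloric_time_independent[OF Suc.prems(1,4)])
    show "central_difference h i u (y, s) = 0" if "h > 0" "s \<le> 0" for h i y s
      by (rule Suc.IH[OF caloric_central_difference[OF Suc.prems(1)]
          parabolic_growth_central_difference[OF Suc.prems(1,2) that(1)] _ that(2)])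
        (simp add: central_difference_def Suc.prems(3))
  qed
  then show ?case using Suc.prems(3) by simp
qed

section \<open>Ancient solutions and harmonic functions as caloric functions\<close>

lemma has_derivative_slice:
  fixes g :: "(real^'n) \<times> real \<Rightarrow> real"
  assumes "(g has_derivative g') (at (x, t) within UNIV \<times> {..0})" "t \<le> 0"
  shows "((\<lambda>y. g (y, t)) has_derivative (\<lambda>v. g' (v, 0))) (at x)"
proof (rule has_derivative_in_compose[of "\<lambda>y. (y, t)" "\<lambda>v. (v, 0)" x UNIV g g'])
  show "((\<lambda>y. (y, t)) has_derivative (\<lambda>v. (v, 0))) (at x)"
    by (intro has_derivative_Pair has_derivative_ident has_derivative_const)
  show "(g has_derivative g') (at (x, t) within range (\<lambda>y. (y, t)))"
    by (rule has_derivative_subset[OF assms(1)]) (use assms(2) in auto)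
qed

lemma Ck_on_2_derivatives:
  assumes "Ck_on 2 S f"
  obtains f' f'' where "\<And>x. x \<in> S \<Longrightarrow> (f has_derivative f' x) (at x within S)"
    "\<And>v x. x \<in> S \<Longrightarrow> ((\<lambda>x. f' x v) has_derivative f'' v x) (at x within S)"
proof -
  from assms obtain f' where f': "\<forall>x\<in>S. (f has_derivative f' x) (at x within S)"
    "\<forall>v. Ck_on 1 S (\<lambda>x. f' x v)" by (auto simp: numeral_2_eq_2)
  have "\<forall>v. \<exists>g. \<forall>x\<in>S. ((\<lambda>x. f' x v) has_derivative g x) (at x within S)"
  proof
    fix v
    from f'(2) have "\<exists>g. (\<forall>x\<in>S. ((\<lambda>x. f' x v) has_derivative g x) (at x within S)) \<and>
        (\<forall>w. continuous_on S (\<lambda>x. g x w))" by simp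
    then show "\<exists>g. \<forall>x\<in>S. ((\<lambda>x. f' x v) has_derivative g x) (at x within S)"
      by (elim exE conjE exI)
  qed
  from choice[OF this] obtain f'' where
    "\<forall>v. \<forall>x\<in>S. ((\<lambda>x. f' x v) has_derivative f'' v x) (at x within S)" ..
  with f'(1) show ?thesis by (intro that) auto
qed

lemma ancient_solution_caloric:
  fixes u :: "(real^'n) \<times> real \<Rightarrow> real"
  assumes u: "ancient_solution u"
  shows "caloric u"
  unfolding caloric_def
proof (intro conjI allI impI)
  have C: "Ck_on k (UNIV \<times> {..0}) u" for k
    using u by (simp add: ancient_solution_def smooth_on_def)
  show "continuous_on (UNIV \<times> {..0}) u" using C[of 0] by simp
  obtain f' f'' where f':
    "\<And>z. z \<in> UNIV \<times> {..0} \<Longrightarrow> (u has_derivative f' z) (at z within UNIV \<times> {..0})"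
    "\<And>v z. z \<in> UNIV \<times> {..0} \<Longrightarrow> ((\<lambda>z. f' z v) has_derivative f'' v z) (at z within UNIV \<times> {..0})"
    using Ck_on_2_derivatives[OF C] by metis
  fix t :: real assume t: "t \<le> 0"
  have 1: "((\<lambda>y. u (y, t)) has_derivative (\<lambda>v. f' (x, t) (v, 0))) (at x)" for x
    by (rule has_derivative_slice[OF f'(1) t]) (use t in simp)
  have 2: "((\<lambda>y. f' (y, t) (w, 0)) has_derivative (\<lambda>v. f'' (w, 0) (x, t) (v, 0))) (at x)" for x w
    by (rule has_derivative_slice[OF f'(2) t]) (use t in simp)
  show "twice_axis_differentiable (\<lambda>y. u (y, t))"
    unfolding twice_axis_differentiable_def
    by (intro exI) (rule axis_derivs_frechet[OF 1 2])
  show "(\<lambda>y. u (y, t)) differentiable at x" for x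
    unfolding differentiable_def by (intro exI) (rule 1)
  show "((\<lambda>s. u (x, s)) has_real_derivative laplacian (\<lambda>y. u (y, t)) x) (at t within {..0})" for x
    using u t by (simp add: ancient_solution_def)
qed

lemma harmonic_caloric:
  fixes u :: "real^'n \<Rightarrow> real"
  assumes u: "harmonic u"
  shows "caloric (\<lambda>z. u (fst z))"
  unfolding caloric_def fst_conv
proof (intro conjI allI impI)
  have C: "Ck_on 2 UNIV u" using u by (simp add: harmonic_def)
  obtain f' f'' where f': "\<And>x. (u has_derivative f' x) (at x)"
    "\<And>v x. ((\<lambda>x. f' x v) has_derivative f'' v x) (at x)"
    by (rule Ck_on_2_derivatives[OF C]) auto
  have "continuous_on UNIV u"
    by (rule has_derivative_continuous_on[OF f'(1)])
  then show "continuous_on (UNIV \<times> {..0}) (\<lambda>z. u (fst z))"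
    by (rule continuous_on_compose2) (auto intro!: continuous_intros)
  show "twice_axis_differentiable u"
    unfolding twice_axis_differentiable_def by (intro exI) (rule axis_derivs_frechet[OF f'])
  show "u differentiable at x" for x
    unfolding differentiable_def by (intro exI) (rule f'(1))
  show "((\<lambda>s. u x) has_real_derivative laplacian u x) (at t within {..0})" for x t
    using u by (simp add: harmonic_def)
qed

text \<open>
  From balls to points one takes \<open>R = \<bar>p\<bar> + 1 + \<bar>x\<bar> + sqrt (- t)\<close>; conversely \<open>p = 0\<close> serves as centre.
\<close>

lemma parabolic_growth_iff:
  fixes u :: "(real^'n) \<times> real \<Rightarrow> real"
  shows "(\<exists>p C. \<forall>R>0. \<forall>x\<in>ball p R. \<forall>t\<in>{-(R\<^sup>2)..0}. \<bar>u (x, t)\<bar> \<le> C * (1 + R) powr real m) \<longleftrightarrow>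
    parabolic_growth m u"
proof
  assume "\<exists>p C. \<forall>R>0. \<forall>x\<in>ball p R. \<forall>t\<in>{-(R\<^sup>2)..0}. \<bar>u (x, t)\<bar> \<le> C * (1 + R) powr real m"
  then obtain p C where *: "\<And>R x t. R > 0 \<Longrightarrow> x \<in> ball p R \<Longrightarrow> t \<in> {-(R\<^sup>2)..0} \<Longrightarrow>
    \<bar>u (x, t)\<bar> \<le> C * (1 + R) powr real m" by blast
  define K where "K = (\<bar>C\<bar> + 1) * (2 + norm p) ^ m"
  have p2: "0 < 2 + norm p" using norm_ge_zero[of p] by linarith
  then have K: "K > 0" by (simp add: K_def add_nonneg_pos)
  have "\<bar>u (x, t)\<bar> \<le> K * (1 + norm x + sqrt (- t)) ^ m" if t: "t \<le> 0" for x t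
  proof -
    define N where "N = 1 + norm x + sqrt (- t)"
    have s: "0 \<le> sqrt (- t)" using t by simp
    have N: "N \<ge> 1" "sqrt (- t) \<le> N" using s by (simp_all add: N_def add_nonneg_nonneg)
    define R where "R = norm p + N"
    have R: "R > 0" using N norm_ge_zero[of p] unfolding R_def by linarith
    have "dist p x \<le> norm p + norm x" by (simp add: dist_norm norm_triangle_ineq4)
    then have x: "x \<in> ball p R" using s unfolding mem_ball R_def N_def by linarith
    have "(sqrt (- t))\<^sup>2 \<le> R\<^sup>2"
      using s N(2) by (intro power_mono) (auto simp: R_def add_increasing)
    then have "t \<in> {-(R\<^sup>2)..0}" using t by simp
    then have "\<bar>u (x, t)\<bar> \<le> C * (1 + R) powr real m" by (rule *[OF R x])
    also have "\<dots> = C * (1 + R) ^ m" using R by (simp add: powr_realpow)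
    also have "\<dots> \<le> (\<bar>C\<bar> + 1) * ((2 + norm p) * N) ^ m"
    proof (rule mult_mono)
      have "norm p * 1 \<le> norm p * N" using N(1) by (intro mult_left_mono) auto
      then have "1 + R \<le> (2 + norm p) * N" using N(1) by (simp add: R_def distrib_right)
      then show "(1 + R) ^ m \<le> ((2 + norm p) * N) ^ m" using R by (intro power_mono) auto
    qed (use R in auto)
    also have "\<dots> = K * N ^ m" by (simp add: K_def power_mult_distrib)
    finally show ?thesis by (simp only: N_def)
  qed
  then show "parabolic_growth m u" unfolding parabolic_growth_def using K by blast
next
  assume "parabolic_growth m u"
  then obtain C where C: "C > 0" "\<And>x t. t \<le> 0 \<Longrightarrow> \<bar>u (x, t)\<bar> \<le> C * (1 + norm x + sqrt (- t)) ^ m"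
    unfolding parabolic_growth_def by blast
  have bound: "\<bar>u (x, t)\<bar> \<le> C * 2 ^ m * (1 + R) powr real m"
    if R: "R > 0" and x: "x \<in> ball 0 R" and t: "t \<in> {-(R\<^sup>2)..0}" for R x t
  proof -
    have "sqrt (- t) \<le> R" using R t by (intro real_le_lsqrt) auto
    then have "1 + norm x + sqrt (- t) \<le> 2 * (1 + R)" using x by simp
    then have "(1 + norm x + sqrt (- t)) ^ m \<le> (2 * (1 + R)) ^ m"
      using t by (intro power_mono) (auto simp: add_nonneg_nonneg)
    then have "C * (1 + norm x + sqrt (- t)) ^ m \<le> C * (2 * (1 + R)) ^ m"
      using C(1) by simp
    also have "\<dots> = C * 2 ^ m * (1 + R) ^ m" by (simp only: power_mult_distrib mult.assoc)
    also have "\<dots> = C * 2 ^ m * (1 + R) powr real m" using R by (simp add: powr_realpow)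
    finally show ?thesis using C(2)[of t x] t by simp
  qed
  show "\<exists>p C. \<forall>R>0. \<forall>x\<in>ball p R. \<forall>t\<in>{-(R\<^sup>2)..0}. \<bar>u (x, t)\<bar> \<le> C * (1 + R) powr real m"
    by (rule exI[of _ 0], rule exI[of _ "C * 2 ^ m"], intro allI impI ballI, rule bound)
qed

lemma ancient_growth_iff:
  "u \<in> ancient_growth (real m) \<longleftrightarrow> ancient_solution u \<and> parabolic_growth m u"
  unfolding ancient_growth_def parabolic_growth_iff[symmetric] by simp

lemma harmonic_growth_iff:
  "u \<in> harmonic_growth (real m) \<longleftrightarrow> harmonic u \<and> parabolic_growth m (\<lambda>z. u (fst z))"
proof -
  have "(\<forall>x\<in>ball p R. \<forall>t\<in>{-(R\<^sup>2)..0}. \<bar>u x\<bar> \<le> C * (1 + R) powr real m) \<longleftrightarrow>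
      (\<forall>x\<in>ball p R. \<bar>u x\<bar> \<le> C * (1 + R) powr real m)" for p C R
  proof -
    have "(0::real) \<in> {-(R\<^sup>2)..0}" by simp
    then show ?thesis by blast
  qed
  then show ?thesis
    unfolding harmonic_growth_def parabolic_growth_iff[symmetric] fst_conv mem_Collect_eq by simp
qed

lemma parabolic_growth_lincomb:
  assumes "parabolic_growth m u" "parabolic_growth m v"
  shows "parabolic_growth m (\<lambda>z. a * u z + b * v z)"
proof -
  obtain C D where C: "C > 0" "\<And>x t. t \<le> 0 \<Longrightarrow> \<bar>u (x, t)\<bar> \<le> C * (1 + norm x + sqrt (- t)) ^ m"
    and D: "D > 0" "\<And>x t. t \<le> 0 \<Longrightarrow> \<bar>v (x, t)\<bar> \<le> D * (1 + norm x + sqrt (- t)) ^ m"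
    using assms unfolding parabolic_growth_def by blast
  have "\<bar>a * u (x, t) + b * v (x, t)\<bar> \<le>
      (\<bar>a\<bar> * C + \<bar>b\<bar> * D + 1) * (1 + norm x + sqrt (- t)) ^ m" if t: "t \<le> 0" for x t
  proof -
    have "\<bar>a * u (x, t) + b * v (x, t)\<bar> \<le> \<bar>a\<bar> * \<bar>u (x, t)\<bar> + \<bar>b\<bar> * \<bar>v (x, t)\<bar>"
      by (simp add: abs_mult[symmetric])
    also have "\<dots> \<le> \<bar>a\<bar> * (C * (1 + norm x + sqrt (- t)) ^ m) + \<bar>b\<bar> * (D * (1 + norm x + sqrt (- t)) ^ m)"
      using C(2)[OF t, of x] D(2)[OF t, of x] by (intro add_mono mult_left_mono) auto
    also have "\<dots> \<le> \<bar>a\<bar> * (C * (1 + norm x + sqrt (- t)) ^ m) + \<bar>b\<bar> * (D * (1 + norm x + sqrt (- t)) ^ m)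
        + (1 + norm x + sqrt (- t)) ^ m"
      using t by (simp add: add_nonneg_nonneg)
    finally show ?thesis by (simp only: distrib_right mult.assoc mult_1)
  qed
  moreover have "\<bar>a\<bar> * C + \<bar>b\<bar> * D + 1 > 0" using C(1) D(1) by (simp add: add_nonneg_pos)
  ultimately show ?thesis unfolding parabolic_growth_def
    by (intro exI[of _ "\<bar>a\<bar> * C + \<bar>b\<bar> * D + 1"] conjI allI impI)
qed

lemma parabolic_growth_sum:
  assumes "\<And>j. j \<in> J \<Longrightarrow> parabolic_growth m (f j)"
  shows "parabolic_growth m (\<lambda>z. \<Sum>j\<in>J. f j z)"
proof -
  have zero: "parabolic_growth m (\<lambda>z. 0)"
    unfolding parabolic_growth_def by (intro exI[of _ 1]) (simp add: add_nonneg_nonneg)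
  show ?thesis
    using assms
  proof (induction J rule: infinite_finite_induct)
    case (insert j J)
    then have "parabolic_growth m (f j)" "parabolic_growth m (\<lambda>z. \<Sum>j\<in>J. f j z)" by simp_all
    from parabolic_growth_lincomb[OF this, of 1 1] insert.hyps show ?case by simp
  qed (simp_all only: sum.infinite sum.empty zero not_False_eq_True)
qed

lemma parabolic_growth_monomial_in_time:
  assumes q: "q \<in> polys l" and m: "2 * j + l \<le> m"
  shows "parabolic_growth m (\<lambda>z. snd z ^ j / fact j * q (fst z))"
proof -
  obtain C where C: "C \<ge> 0" "\<And>x. \<bar>q x\<bar> \<le> C * (1 + norm x) ^ l"
    using polys_growth[OF q] by blast
  have "\<bar>t ^ j / fact j * q x\<bar> \<le> (C + 1) * (1 + norm x + sqrt (- t)) ^ m" if t: "t \<le> 0" for x t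
  proof -
    define N where "N = 1 + norm x + sqrt (- t)"
    have s: "0 \<le> sqrt (- t)" using t by simp
    have N: "N \<ge> 1" "sqrt (- t) \<le> N" "1 + norm x \<le> N" using s by (simp_all add: N_def)
    have "\<bar>t ^ j\<bar> = (sqrt (- t)) ^ (2 * j)" using t by (simp add: power_mult power_abs)
    then have "\<bar>t ^ j\<bar> \<le> N ^ (2 * j)" using s N(2) by (simp only:) (intro power_mono)
    moreover have "\<bar>t ^ j / fact j\<bar> \<le> \<bar>t ^ j\<bar>"
      using mult_left_mono[OF fact_ge_1[of j], of "\<bar>t ^ j\<bar>"] by (simp add: divide_le_eq)
    ultimately have tj: "\<bar>t ^ j / fact j\<bar> \<le> N ^ (2 * j)" by linarith
    have "(1 + norm x) ^ l \<le> N ^ l" using N(3) by (intro power_mono) auto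
    then have "C * (1 + norm x) ^ l \<le> (C + 1) * N ^ l" using C(1) N(1) by (intro mult_mono) auto
    then have qx: "\<bar>q x\<bar> \<le> (C + 1) * N ^ l" using C(2)[of x] by linarith
    have "\<bar>t ^ j / fact j * q x\<bar> = \<bar>t ^ j / fact j\<bar> * \<bar>q x\<bar>" by (rule abs_mult)
    also have "\<dots> \<le> N ^ (2 * j) * ((C + 1) * N ^ l)" using tj qx N(1) by (intro mult_mono) auto
    also have "\<dots> = (C + 1) * N ^ (2 * j + l)" by (simp only: power_add mult.left_commute)
    also have "\<dots> \<le> (C + 1) * N ^ m"
      using C(1) N(1) m by (intro mult_left_mono power_increasing) auto
    finally show ?thesis by (simp only: N_def)
  qed
  then show ?thesis
    unfolding parabolic_growth_def using C(1) by (intro exI[of _ "C + 1"]) simp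
qed

section \<open>The ancient solution with given polynomial final values\<close>

lemma iterated_laplacian_in_polys:
  assumes "p \<in> polys (2 * k)" "j \<le> k"
  shows "(laplacian ^^ j) p \<in> polys (2 * (k - j))"
  using assms(2)
proof (induction j)
  case (Suc j)
  then have "(laplacian ^^ j) p \<in> polys (2 * (k - j))" by simp
  moreover have "2 * (k - j) = 2 * (k - Suc j) + 2" using Suc.prems by simp
  ultimately have "(laplacian ^^ j) p \<in> polys (2 * (k - Suc j) + 2)" by (simp only:)
  then show ?case using laplacian_in_polys by (simp only: funpow.simps o_apply)
qed (use assms(1) in simp)

lemma iterated_laplacian_vanishes:
  assumes "p \<in> polys (2 * k)"
  shows "(laplacian ^^ Suc k) p = (\<lambda>x. 0)"
  using iterated_laplacian_in_polys[OF assms order_refl] laplacian_polys_0 by simp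

lemma iterated_laplacian_lincomb:
  assumes "p \<in> polys (2 * k)" "q \<in> polys (2 * k)" "j \<le> k"
  shows "(laplacian ^^ j) (\<lambda>x. a * p x + b * q x) =
    (\<lambda>x. a * (laplacian ^^ j) p x + b * (laplacian ^^ j) q x)"
  using assms(3)
proof (induction j)
  case (Suc j)
  then have IH: "(laplacian ^^ j) (\<lambda>x. a * p x + b * q x) =
    (\<lambda>x. a * (laplacian ^^ j) p x + b * (laplacian ^^ j) q x)" and j: "j \<le> k" by auto
  show ?case
    unfolding funpow.simps o_apply IH
    by (rule laplacian_polys_lincomb[OF iterated_laplacian_in_polys[OF assms(1) j]
          iterated_laplacian_in_polys[OF assms(2) j]])
qed simp

text \<open>
  With \<open>L\<close> the Laplacian, the exponential series \<open>exp (t L) p\<close>, which terminates on polynomials of degree at most \<open>2 * k\<close>, set to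
  zero for positive times as the encoding of ancient solutions demands.
\<close>

definition heat_extension :: "nat \<Rightarrow> (real^'n \<Rightarrow> real) \<Rightarrow> (real^'n) \<times> real \<Rightarrow> real" where
  "heat_extension k p z =
    (if snd z \<le> 0 then \<Sum>j\<le>k. snd z ^ j / fact j * (laplacian ^^ j) p (fst z) else 0)"

lemma heat_extension_at_0: "heat_extension k p (x, 0) = p x"
proof -
  have "(\<Sum>j\<le>k. (0::real) ^ j / fact j * (laplacian ^^ j) p x) = p x"
    by (subst sum.atMost_shift) simp
  then show ?thesis by (simp add: heat_extension_def)
qed

text \<open>
  Term by term differentiation of a truncated exponential sum leaves out its last term, which is zero in
  the application because \<open>c (Suc k)\<close> is the first vanishing iterated Laplacian.
\<close>

lemma exponential_sum_shift:
  fixes t :: real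
  shows "(\<Sum>j\<le>k. real j * t ^ (j - 1) / fact j * c j) + t ^ k / fact k * c (Suc k) =
    (\<Sum>j\<le>k. t ^ j / fact j * c (Suc j))"
proof (induction k)
  case (Suc k)
  have "real (Suc k) * t ^ (Suc k - 1) / fact (Suc k) = t ^ k / fact k"
    by (simp del: of_nat_Suc)
  then show ?case using Suc by simp
qed simp

lemma heat_extension_ancient_solution:
  fixes p :: "real^'n \<Rightarrow> real"
  assumes p: "p \<in> polys (2 * k)"
  shows "ancient_solution (heat_extension k p)"
  unfolding ancient_solution_def
proof (intro conjI allI impI)
  let ?c = "\<lambda>j. (laplacian ^^ j) p"
  let ?P = "\<lambda>z. \<Sum>j\<le>k. snd z ^ j / fact j * ?c j (fst z)"
  have c: "?c j \<in> polys (2 * (k - j))" if "j \<le> k" for j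
    by (rule iterated_laplacian_in_polys[OF p that])
  have "real_polynomial_function ?P"
  proof (rule real_polynomial_function_sum)
    fix j assume j: "j \<in> {..k}"
    have "real_polynomial_function (?c j \<circ> fst)"
      by (rule real_polynomial_function_compose[OF polynomial_function_bounded_linear
            real_polynomial_function_polys[OF c]]) (use j in \<open>auto intro: bounded_linear_fst\<close>)
    moreover have "real_polynomial_function (\<lambda>z::(real^'n) \<times> real. snd z ^ j)"
      by (intro real_polynomial_function_power real_polynomial_function.intros(1) bounded_linear_snd)
    ultimately have "real_polynomial_function
        (\<lambda>z::(real^'n) \<times> real. (inverse (fact j) * snd z ^ j) * (?c j \<circ> fst) z)"
      by (intro real_polynomial_function.intros(2,4))
    then show "real_polynomial_function (\<lambda>z::(real^'n) \<times> real. snd z ^ j / fact j * ?c j (fst z))"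
      by (simp only: o_apply divide_inverse mult.commute)
  qed simp
  then have "Ck_on l (UNIV \<times> {..0}) ?P" for l by (rule real_polynomial_function_Ck_on)
  then have "Ck_on l (UNIV \<times> {..0}) (heat_extension k p)" for l
    by (rule Ck_on_cong) (auto simp: heat_extension_def)
  then show "smooth_on (UNIV \<times> {..0}) (heat_extension k p)" by (simp add: smooth_on_def)
  show "heat_extension k p (x, t) = 0" if "t > 0" for x t
    using that by (simp add: heat_extension_def)
  fix x and t :: real assume t: "t \<le> 0"
  have lap: "laplacian (\<lambda>y. heat_extension k p (y, t)) x = (\<Sum>j\<le>k. t ^ j / fact j * ?c (Suc j) x)"
  proof -
    have "(\<lambda>y. heat_extension k p (y, t)) = (\<lambda>y. \<Sum>j\<le>k. t ^ j / fact j * ?c j y)"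
      using t by (simp add: heat_extension_def)
    moreover have "laplacian (\<lambda>y. \<Sum>j\<in>{..k}. t ^ j / fact j * ?c j y) x =
        (\<Sum>j\<in>{..k}. t ^ j / fact j * laplacian (?c j) x)"
      by (rule laplacian_sum[THEN conjunct2]) (rule polys_twice_axis_differentiable[OF c], simp)
    ultimately show ?thesis by simp
  qed
  have "((\<lambda>s. \<Sum>j\<le>k. s ^ j / fact j * ?c j x) has_real_derivative
      (\<Sum>j\<le>k. real j * t ^ (j - 1) / fact j * ?c j x)) (at t within {..0})"
  proof (rule DERIV_sum)
    fix j
    show "((\<lambda>s. s ^ j / fact j * ?c j x) has_real_derivative real j * t ^ (j - 1) / fact j * ?c j x)
        (at t within {..0})"
      using DERIV_pow[of j t "{..0}"] by (intro DERIV_cmult_right DERIV_cdivide) simp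
  qed
  moreover have "(\<Sum>j\<le>k. real j * t ^ (j - 1) / fact j * ?c j x) =
      laplacian (\<lambda>y. heat_extension k p (y, t)) x"
    using exponential_sum_shift[of t "\<lambda>j. ?c j x" k] iterated_laplacian_vanishes[OF p]
    unfolding lap by simp
  ultimately have "((\<lambda>s. \<Sum>j\<le>k. s ^ j / fact j * ?c j x) has_real_derivative
      laplacian (\<lambda>y. heat_extension k p (y, t)) x) (at t within {..0})"
    by (simp only:)
  then show "((\<lambda>s. heat_extension k p (x, s)) has_real_derivative
      laplacian (\<lambda>y. heat_extension k p (y, t)) x) (at t within {..0})"
    by (rule has_field_derivative_transform_within[where d = 1])
      (use t in \<open>auto simp: heat_extension_def\<close>)
qed

text \<open>
  The iterated Laplacian of order \<open>j\<close> lowers the degree by \<open>2 j\<close>, exactly the parabolic weight of \<open>t\<^sup>j\<close>.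
\<close>

lemma heat_extension_growth:
  assumes p: "p \<in> polys (2 * k)"
  shows "parabolic_growth (2 * k) (heat_extension k p)"
proof -
  have "parabolic_growth (2 * k) (\<lambda>z. \<Sum>j\<le>k. snd z ^ j / fact j * (laplacian ^^ j) p (fst z))"
  proof (rule parabolic_growth_sum)
    fix j assume "j \<in> {..k}"
    then show "parabolic_growth (2 * k) (\<lambda>z. snd z ^ j / fact j * (laplacian ^^ j) p (fst z))"
      by (intro parabolic_growth_monomial_in_time[OF iterated_laplacian_in_polys[OF p]]) auto
  qed
  then show ?thesis by (simp add: parabolic_growth_def heat_extension_def)
qed

text \<open>
  Surjectivity: the final values of an ancient solution are a polynomial \<open>p\<close>, and its difference to the
  heat extension of \<open>p\<close> vanishes at time zero, hence everywhere.
\<close>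

lemma heat_extension_image:
  "heat_extension k ` polys (2 * k) =
    (ancient_growth (real (2 * k)) :: ((real^'n) \<times> real \<Rightarrow> real) set)"
proof (intro equalityI subsetI)
  fix u :: "(real^'n) \<times> real \<Rightarrow> real"
  assume "u \<in> heat_extension k ` polys (2 * k)"
  then show "u \<in> ancient_growth (real (2 * k))"
    unfolding ancient_growth_iff
    using heat_extension_ancient_solution heat_extension_growth by blast
next
  fix u :: "(real^'n) \<times> real \<Rightarrow> real"
  assume "u \<in> ancient_growth (real (2 * k))"
  then have u: "ancient_solution u" "parabolic_growth (2 * k) u" "caloric u"
    using ancient_solution_caloric unfolding ancient_growth_iff by auto
  define p where "p x = u (x, 0)" for x
  have p: "p \<in> polys (2 * k)"
    unfolding p_def[abs_def] by (rule caloric_slice_in_polys[OF u(3,2)]) simp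
  note h = heat_extension_ancient_solution[OF p]
  have "u (x, t) = heat_extension k p (x, t)" for x t
  proof (cases "t \<le> 0")
    case True
    have "1 * u (x, t) + (- 1) * heat_extension k p (x, t) = 0"
    proof (rule caloric_unique[of "\<lambda>z. 1 * u z + (- 1) * heat_extension k p z", OF _ _ _ True])
      show "caloric (\<lambda>z. 1 * u z + (- 1) * heat_extension k p z)"
        by (rule caloric_lincomb[OF u(3) ancient_solution_caloric[OF h]])
      show "parabolic_growth (2 * k) (\<lambda>z. 1 * u z + (- 1) * heat_extension k p z)"
        by (rule parabolic_growth_lincomb[OF u(2) heat_extension_growth[OF p]])
    qed (simp add: heat_extension_at_0 p_def)
    then show ?thesis by simp
  next
    case False
    then show ?thesis using u(1) h by (simp add: ancient_solution_def)
  qed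
  then have "u = heat_extension k p" by auto
  then show "u \<in> heat_extension k ` polys (2 * k)" using p by blast
qed

section \<open>Counting dimensions\<close>

lemma polys_finite_dimensional:
  obtains S :: "(real^'n \<Rightarrow> real) set" where "finite S" "polys m \<subseteq> real_fun.span S"
proof
  show "finite (monomial ` {a :: 'n \<Rightarrow> nat. sum a UNIV \<le> m})"
    by (intro finite_imageI finite_multi_indices)
qed (simp add: polys_def)

lemma fun_dim_ancient_growth:
  "fun_dim (ancient_growth (real (2 * k)) :: ((real^'n) \<times> real \<Rightarrow> real) set) =
    fun_dim (polys (2 * k) :: (real^'n \<Rightarrow> real) set)"
proof -
  obtain S :: "(real^'n \<Rightarrow> real) set" where S: "finite S" "polys (2 * k) \<subseteq> real_fun.span S"
    by (rule polys_finite_dimensional)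
  have lin: "heat_extension k (\<lambda>x. a * p x + b * q x) z =
      a * heat_extension k p z + b * heat_extension k q z"
    if "p \<in> polys (2 * k)" "q \<in> polys (2 * k)" for a b z and p q :: "real^'n \<Rightarrow> real"
  proof -
    have "(\<Sum>j\<le>k. snd z ^ j / fact j * (laplacian ^^ j) (\<lambda>x. a * p x + b * q x) (fst z)) =
        (\<Sum>j\<le>k. a * (snd z ^ j / fact j * (laplacian ^^ j) p (fst z)) +
          b * (snd z ^ j / fact j * (laplacian ^^ j) q (fst z)))"
      by (rule sum.cong[OF refl]) (simp add: iterated_laplacian_lincomb[OF that] algebra_simps)
    then show ?thesis by (simp add: heat_extension_def sum.distrib sum_distrib_left)
  qed
  have "fun_dim (heat_extension k ` (polys (2 * k) :: (real^'n \<Rightarrow> real) set)) = fun_dim (polys (2 * k) :: (real^'n \<Rightarrow> real) set)"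
  proof (rule fun_dim_image_inj[OF subspace_polys S])
    fix p q :: "real^'n \<Rightarrow> real" assume pq: "p \<in> polys (2 * k)" "q \<in> polys (2 * k)"
    have "heat_extension k (\<lambda>x. p x + q x) z = heat_extension k p z + heat_extension k q z" for z
      using lin[OF pq, of 1 1 z] by simp
    then show "heat_extension k (p + q) = heat_extension k p + heat_extension k q"
      unfolding plus_fun_def by (intro ext)
  next
    fix c and p :: "real^'n \<Rightarrow> real" assume p: "p \<in> polys (2 * k)"
    have "heat_extension k (\<lambda>x. c * p x) z = c * heat_extension k p z" for z
      using lin[OF p p, of c 0 z] by simp
    then show "heat_extension k (\<lambda>x. c * p x) = (\<lambda>z. c * heat_extension k p z)" by (intro ext)
  next
    fix p :: "real^'n \<Rightarrow> real" assume 0: "heat_extension k p = 0"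
    have "p x = 0" for x using heat_extension_at_0[of k p x] unfolding 0 by simp
    then show "p = 0" unfolding zero_fun_def by (rule ext)
  qed
  then show ?thesis by (simp only: heat_extension_image)
qed

text \<open>
  One inclusion is the Liouville theorem: a harmonic function of growth order \<open>m\<close>, viewed as a caloric function
  constant in time, is its own slice.
\<close>

lemma harmonic_growth_eq_polys:
  "harmonic_growth (real m) = {p \<in> polys m. laplacian p = 0}"
proof (intro equalityI subsetI)
  fix u :: "real^'n \<Rightarrow> real" assume "u \<in> harmonic_growth (real m)"
  then have u: "harmonic u" "parabolic_growth m (\<lambda>z. u (fst z))"
    unfolding harmonic_growth_iff by auto
  have "u \<in> polys m"
    using caloric_slice_in_polys[OF harmonic_caloric[OF u(1)] u(2), of 0] by simp
  moreover have "laplacian u = 0"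
    unfolding zero_fun_def using u(1) by (intro ext) (simp add: harmonic_def)
  ultimately show "u \<in> {p \<in> polys m. laplacian p = 0}" by simp
next
  fix p :: "real^'n \<Rightarrow> real" assume "p \<in> {p \<in> polys m. laplacian p = 0}"
  then have p: "p \<in> polys m" "laplacian p = 0" by auto
  have "harmonic p"
    unfolding harmonic_def p(2)
    using real_polynomial_function_Ck_on[OF real_polynomial_function_polys[OF p(1)]] by simp
  moreover have "parabolic_growth m (\<lambda>z. p (fst z))"
    using parabolic_growth_monomial_in_time[OF p(1), of 0 m] by simp
  ultimately show "p \<in> harmonic_growth (real m)" unfolding harmonic_growth_iff by simp
qed

text \<open>
  Rank and nullity of the Laplacian, which maps \<open>polys (m + 2)\<close> onto \<open>polys m\<close>.
\<close>

lemma fun_dim_polys_step: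
  "fun_dim (polys (m + 2) :: (real^'n \<Rightarrow> real) set) =
    fun_dim (harmonic_growth (real (m + 2)) :: (real^'n \<Rightarrow> real) set) +
    fun_dim (polys m :: (real^'n \<Rightarrow> real) set)"
proof -
  obtain S :: "(real^'n \<Rightarrow> real) set" where S: "finite S" "polys (m + 2) \<subseteq> real_fun.span S"
    by (rule polys_finite_dimensional)
  have "fun_dim (polys (m + 2) :: (real^'n \<Rightarrow> real) set) =
      fun_dim {p :: real^'n \<Rightarrow> real. p \<in> polys (m + 2) \<and> laplacian p = 0} +
      fun_dim (laplacian ` (polys (m + 2) :: (real^'n \<Rightarrow> real) set))"
  proof (rule fun_dim_rank_nullity[OF subspace_polys S])
    fix p q :: "real^'n \<Rightarrow> real" assume pq: "p \<in> polys (m + 2)" "q \<in> polys (m + 2)"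
    show "laplacian (p + q) = laplacian p + laplacian q"
      using laplacian_polys_lincomb[OF pq, of 1 1] unfolding plus_fun_def by (simp only: mult_1)
  next
    fix c and p :: "real^'n \<Rightarrow> real" assume p: "p \<in> polys (m + 2)"
    show "laplacian (\<lambda>x. c * p x) = (\<lambda>x. c * laplacian p x)"
      using laplacian_polys_lincomb[OF p p, of c 0] by simp
  qed
  then show ?thesis by (simp only: laplacian_onto_polys harmonic_growth_eq_polys)
qed

lemma fun_dim_polys:
  "fun_dim (polys (2 * k) :: (real^'n \<Rightarrow> real) set) =
    (\<Sum>i=0..k. fun_dim (harmonic_growth (real (2 * i)) :: (real^'n \<Rightarrow> real) set))"
proof (induction k)
  case 0
  have "{p \<in> polys 0. laplacian p = 0} = (polys 0 :: (real^'n \<Rightarrow> real) set)"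
    using laplacian_polys_0 unfolding zero_fun_def by blast
  then have "harmonic_growth (real 0) = (polys 0 :: (real^'n \<Rightarrow> real) set)"
    by (simp only: harmonic_growth_eq_polys)
  then show ?case by simp
next
  case (Suc k)
  have eq: "2 * Suc k = 2 * k + 2" by simp
  have "fun_dim (polys (2 * Suc k) :: (real^'n \<Rightarrow> real) set) =
      fun_dim (harmonic_growth (real (2 * Suc k)) :: (real^'n \<Rightarrow> real) set) +
      fun_dim (polys (2 * k) :: (real^'n \<Rightarrow> real) set)"
    unfolding eq by (rule fun_dim_polys_step)
  then show ?case by (simp only: Suc.IH sum.atLeast0_atMost_Suc add.commute)
qed

theorem corollary3p18:
  fixes k :: nat
  shows "fun_dim (ancient_growth (real (2 * k)) :: ((real^'n) \<times> real \<Rightarrow> real) set) =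
    (\<Sum>i=0..k. fun_dim (harmonic_growth (real (2 * i)) :: (real^'n \<Rightarrow> real) set))"
  by (simp only: fun_dim_ancient_growth fun_dim_polys)

end
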